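(* Let $\mathcal M$ be the class of topological spaces that are homeomorphic to disjoint unions of spaces of the form $\mathbf R^n$ ($n\ge 0$). The class of all open covers of spaces in $\mathcal M$ is the smallest class $C$ of open covers of spaces in $\mathcal M$ that satisfies the following conditions. (1) For every $n\ge1$, the class $C$ contains the open cover $\{U,V\}$ of $\mathbf R^n$, where $$U=\bigcup_{i\in\mathbf Z}(4i,4i+3)\times\mathbf R^{n-1},\qquad V=\bigcup_{i\in\mathbf Z}(4i+2,4i+5)\times\mathbf R^{n-1}.$$ (2) $C$ contains all open covers (of spaces in $\mathcal M$) with pairwise disjoint elements, indexed by arbitrary sets. (3) (Coarsening.) If $U$ and $V$ are open covers of a space $X\in\mathcal M$, $U\in C$, and $U$ refines $V$, then $V\in C$. (4) (Composition.) If an open cover $\{U_i\}_{i\in I}$ of $X$ belongs to $C$ and $\iota\colon X\to Y$ is an isomorphism (homeomorphism), then the open cover $\{\iota(U_i)\}_{i\in I}$ of $Y$ belongs to $C$; and if an open cover $\{U_i\}_{i\in I}$ of $X$ belongs to $C$, and for every $i\in I$ we are given an open cover $\{V_{i,j}\}_{j\in J_i}$ of $U_i$ that belongs to $C$ (in particular $U_i\in\mathcal M$), then the open cover $\{V_{i,j}\}_{i\in I,j\in J_i}$ of $X$ belongs to $C$. The statement continues to hold if smooth manifolds and smooth maps are used instead of topological spaces and continuous maps (i.e., $\mathcal M$ consists of smooth manifolds diffeomorphic to disjoint unions of spaces $\mathbf R^n$, and isomorphisms are diffeomorphisms).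
   Context: An open cover $U$ refines an open cover $V$ of the same space if every element of $U$ is contained in some element of $V$. Different components of a disjoint union may have different dimensions, and the disjoint union may have an arbitrary indexing set (possibly empty). *)

theory Defs
  imports "HOL-Analysis.Analysis"
begin

text \<open>
  HOL has no proper classes, so the points of the spaces and the indices of the families are taken
  from one type \<open>'u\<close>, which plays the role of the universe. \<open>R^n\<close> is the library's \<open>Euclidean_space n\<close>,
  whose points are the \<open>x :: nat \<Rightarrow> real\<close> with \<open>x i = 0\<close> for \<open>i \<ge> n\<close>; a function
  \<open>c :: (nat \<Rightarrow> real) \<Rightarrow> 'u\<close>, assumed to be injective, places the \<open>R^n\<close> in the universe.
\<close>

section \<open>Open covers\<close>

definition open_cover :: "'a topology \<Rightarrow> 'i set \<Rightarrow> ('i \<Rightarrow> 'a set) \<Rightarrow> bool" where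
  "open_cover X I U \<longleftrightarrow> (\<forall>i\<in>I. openin X (U i)) \<and> (\<Union>i\<in>I. U i) = topspace X"

definition refines :: "'i set \<Rightarrow> ('i \<Rightarrow> 'a set) \<Rightarrow> 'j set \<Rightarrow> ('j \<Rightarrow> 'a set) \<Rightarrow> bool" where
  "refines I U J V \<longleftrightarrow> (\<forall>i\<in>I. \<exists>j\<in>J. U i \<subseteq> V j)"

definition stripes_U :: "nat \<Rightarrow> (nat \<Rightarrow> real) set" where
  "stripes_U n = (\<Union>i::int. {x \<in> topspace (Euclidean_space n). x 0 \<in> {4 * of_int i <..< 4 * of_int i + 3}})"

definition stripes_V :: "nat \<Rightarrow> (nat \<Rightarrow> real) set" where
  "stripes_V n = (\<Union>i::int. {x \<in> topspace (Euclidean_space n). x 0 \<in> {4 * of_int i + 2 <..< 4 * of_int i + 5}})"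

text \<open>
  The definitions of this section serve topological spaces and smooth manifolds alike. The spaces
  are the elements of a type \<open>'s\<close>; \<open>tp\<close> gives the underlying topology, \<open>sub X W\<close> is the open
  subspace \<open>W\<close> of \<open>X\<close>, \<open>isom X Y f\<close> says that \<open>f\<close> is an isomorphism from \<open>X\<close> to \<open>Y\<close>, \<open>Rn n\<close> is the
  copy of \<open>R^n\<close> with underlying set \<open>c ` R^n\<close>, and \<open>M\<close> is the class of spaces.
\<close>

type_synonym ('s, 'u) cover = "'s \<times> 'u set \<times> ('u \<Rightarrow> 'u set)"

definition all_covers :: "('s \<Rightarrow> 'u topology) \<Rightarrow> 's set \<Rightarrow> ('s, 'u) cover set" where
  "all_covers tp M = {(X, I, U). X \<in> M \<and> open_cover (tp X) I U}"

definition contains_stripes ::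
  "(nat \<Rightarrow> 's) \<Rightarrow> ((nat \<Rightarrow> real) \<Rightarrow> 'u) \<Rightarrow> ('s, 'u) cover set \<Rightarrow> bool" where
  "contains_stripes Rn c C \<longleftrightarrow>
     (\<forall>n\<ge>1. \<forall>a b. a \<noteq> b \<longrightarrow>
        (Rn n, {a, b}, \<lambda>i. if i = a then c ` stripes_U n else c ` stripes_V n) \<in> C)"

definition contains_disjoint ::
  "('s \<Rightarrow> 'u topology) \<Rightarrow> 's set \<Rightarrow> ('s, 'u) cover set \<Rightarrow> bool" where
  "contains_disjoint tp M C \<longleftrightarrow>
     (\<forall>X\<in>M. \<forall>I U. open_cover (tp X) I U \<and> disjoint_family_on U I \<longrightarrow> (X, I, U) \<in> C)"

definition coarsening_closed ::
  "('s \<Rightarrow> 'u topology) \<Rightarrow> 's set \<Rightarrow> ('s, 'u) cover set \<Rightarrow> bool" where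
  "coarsening_closed tp M C \<longleftrightarrow>
     (\<forall>X\<in>M. \<forall>I U J V. open_cover (tp X) I U \<and> open_cover (tp X) J V \<and>
        (X, I, U) \<in> C \<and> refines I U J V \<longrightarrow> (X, J, V) \<in> C)"

definition iso_closed ::
  "('s \<Rightarrow> 's \<Rightarrow> ('u \<Rightarrow> 'u) \<Rightarrow> bool) \<Rightarrow> 's set \<Rightarrow> ('s, 'u) cover set \<Rightarrow> bool" where
  "iso_closed isom M C \<longleftrightarrow>
     (\<forall>X\<in>M. \<forall>Y\<in>M. \<forall>I U f. (X, I, U) \<in> C \<and> isom X Y f \<longrightarrow> (Y, I, \<lambda>i. f ` U i) \<in> C)"

text \<open>
  The family \<open>V i j\<close> is indexed by the pairs in \<open>SIGMA i:I. J i\<close>; the bijection \<open>p\<close> encodes this index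
  set by a subset \<open>K\<close> of the universe.
\<close>

definition composition_closed ::
  "('s \<Rightarrow> 'u set \<Rightarrow> 's) \<Rightarrow> ('s, 'u) cover set \<Rightarrow> bool" where
  "composition_closed sub C \<longleftrightarrow>
     (\<forall>X I U J V K p. (X, I, U) \<in> C \<and> (\<forall>i\<in>I. (sub X (U i), J i, V i) \<in> C) \<and>
        bij_betw p K (SIGMA i:I. J i) \<longrightarrow>
        (X, K, \<lambda>k. V (fst (p k)) (snd (p k))) \<in> C)"

definition admissible ::
  "('s \<Rightarrow> 'u topology) \<Rightarrow> ('s \<Rightarrow> 'u set \<Rightarrow> 's) \<Rightarrow> ('s \<Rightarrow> 's \<Rightarrow> ('u \<Rightarrow> 'u) \<Rightarrow> bool) \<Rightarrow>
   (nat \<Rightarrow> 's) \<Rightarrow> ((nat \<Rightarrow> real) \<Rightarrow> 'u) \<Rightarrow> 's set \<Rightarrow> ('s, 'u) cover set \<Rightarrow> bool" where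
  "admissible tp sub isom Rn c M C \<longleftrightarrow>
     C \<subseteq> all_covers tp M \<and>
     contains_stripes Rn c C \<and>
     contains_disjoint tp M C \<and>
     coarsening_closed tp M C \<and>
     iso_closed isom M C \<and>
     composition_closed sub C"

definition is_smallest :: "('a set \<Rightarrow> bool) \<Rightarrow> 'a set \<Rightarrow> bool" where
  "is_smallest P A \<longleftrightarrow> P A \<and> (\<forall>C. P C \<longrightarrow> A \<subseteq> C)"


section \<open>Topological spaces\<close>

text \<open>
  Restricting the index sets to subsets of \<open>'u\<close> is no loss: the summands are nonempty, so a
  disjoint union with points in \<open>'u\<close> has at most as many summands as \<open>'u\<close> has elements.
\<close>

definition M_top :: "'u topology set" where
  "M_top = {X. \<exists>(I :: 'u set) (d :: 'u \<Rightarrow> nat).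
     X homeomorphic_space sum_topology (\<lambda>i. Euclidean_space (d i)) I}"

definition Rn_top :: "((nat \<Rightarrow> real) \<Rightarrow> 'u) \<Rightarrow> nat \<Rightarrow> 'u topology" where
  "Rn_top c n = pullback_topology (c ` topspace (Euclidean_space n)) (inv c) (Euclidean_space n)"


section \<open>Smooth maps between subsets of Euclidean spaces\<close>

text \<open>
  \<open>Ck_on n k S f\<close>: all partial derivatives of \<open>f\<close> of order at most \<open>k\<close> exist and are continuous on \<open>S\<close>,
  for \<open>S\<close> an open subset of \<open>R^n\<close>. The derivative with respect to the \<open>i\<close>-th coordinate is taken along
  \<open>x(i := t)\<close>, which stays in \<open>R^n\<close> for \<open>i < n\<close>.
\<close>

primrec Ck_on :: "nat \<Rightarrow> nat \<Rightarrow> (nat \<Rightarrow> real) set \<Rightarrow> ((nat \<Rightarrow> real) \<Rightarrow> real) \<Rightarrow> bool" where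
  "Ck_on n 0 S f \<longleftrightarrow> continuous_map (subtopology (Euclidean_space n) S) euclideanreal f"
| "Ck_on n (Suc k) S f \<longleftrightarrow>
     continuous_map (subtopology (Euclidean_space n) S) euclideanreal f \<and>
     (\<exists>f'. \<forall>i<n. (\<forall>x\<in>S. ((\<lambda>t. f (x(i := t))) has_real_derivative f' i x) (at (x i))) \<and>
                 Ck_on n k S (f' i))"

definition smooth_between ::
  "nat \<Rightarrow> nat \<Rightarrow> (nat \<Rightarrow> real) set \<Rightarrow> ((nat \<Rightarrow> real) \<Rightarrow> nat \<Rightarrow> real) \<Rightarrow> bool" where
  "smooth_between n m S F \<longleftrightarrow> (\<forall>j<m. \<forall>k. Ck_on n k S (\<lambda>x. F x j))"


section \<open>Smooth manifolds\<close>

text \<open>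
  A chart \<open>(n, D, \<phi>)\<close> is a homeomorphism \<open>\<phi>\<close> from the open set \<open>D\<close> onto an open subset of \<open>R^n\<close>; values of
  \<open>\<phi>\<close> outside \<open>D\<close> are irrelevant. The dimension \<open>n\<close> may vary between the charts of a manifold.
\<close>

type_synonym 'a chart = "nat \<times> 'a set \<times> ('a \<Rightarrow> nat \<Rightarrow> real)"

definition is_chart :: "'a topology \<Rightarrow> 'a chart \<Rightarrow> bool" where
  "is_chart X = (\<lambda>(n, D, \<phi>). openin X D \<and> openin (Euclidean_space n) (\<phi> ` D) \<and>
     homeomorphic_map (subtopology X D) (subtopology (Euclidean_space n) (\<phi> ` D)) \<phi>)"

record 'a mfd =
  mtop :: "'a topology"
  atlas :: "'a chart set"

text \<open>
  Atlases need not be maximal: two atlases on one topology define the same smooth structure iff the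
  identity is a diffeomorphism. Second countability is not required, because disjoint unions
  over arbitrary index sets are allowed.
\<close>

definition smooth_manifold :: "'a mfd \<Rightarrow> bool" where
  "smooth_manifold X \<longleftrightarrow>
     Hausdorff_space (mtop X) \<and>
     (\<forall>h\<in>atlas X. is_chart (mtop X) h) \<and>
     (\<Union>(n, D, \<phi>)\<in>atlas X. D) = topspace (mtop X) \<and>
     (\<forall>(n, D, \<phi>)\<in>atlas X. \<forall>(m, E, \<psi>)\<in>atlas X.
        smooth_between n m (\<phi> ` (D \<inter> E)) (\<psi> \<circ> inv_into D \<phi>))"

definition smooth_map :: "'a mfd \<Rightarrow> 'b mfd \<Rightarrow> ('a \<Rightarrow> 'b) \<Rightarrow> bool" where
  "smooth_map X Y f \<longleftrightarrow>
     continuous_map (mtop X) (mtop Y) f \<and>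
     (\<forall>(n, D, \<phi>)\<in>atlas X. \<forall>(m, E, \<psi>)\<in>atlas Y.
        smooth_between n m (\<phi> ` (D \<inter> f -` E)) (\<psi> \<circ> f \<circ> inv_into D \<phi>))"

definition diffeo :: "'a mfd \<Rightarrow> 'b mfd \<Rightarrow> ('a \<Rightarrow> 'b) \<Rightarrow> bool" where
  "diffeo X Y f \<longleftrightarrow>
     bij_betw f (topspace (mtop X)) (topspace (mtop Y)) \<and>
     smooth_map X Y f \<and> smooth_map Y X (inv_into (topspace (mtop X)) f)"

definition open_submfd :: "'a mfd \<Rightarrow> 'a set \<Rightarrow> 'a mfd" where
  "open_submfd X W =
     \<lparr>mtop = subtopology (mtop X) W, atlas = (\<lambda>(n, D, \<phi>). (n, D \<inter> W, \<phi>)) ` atlas X\<rparr>"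

definition disjoint_union_mfd :: "('i \<Rightarrow> 'a mfd) \<Rightarrow> 'i set \<Rightarrow> ('i \<times> 'a) mfd" where
  "disjoint_union_mfd X I =
     \<lparr>mtop = sum_topology (\<lambda>i. mtop (X i)) I,
      atlas = (\<Union>i\<in>I. (\<lambda>(n, D, \<phi>). (n, {i} \<times> D, \<phi> \<circ> snd)) ` atlas (X i))\<rparr>"

definition Euclidean_mfd :: "nat \<Rightarrow> (nat \<Rightarrow> real) mfd" where
  "Euclidean_mfd n =
     \<lparr>mtop = Euclidean_space n, atlas = {(n, topspace (Euclidean_space n), id)}\<rparr>"

definition M_smooth :: "'u mfd set" where
  "M_smooth = {X. smooth_manifold X \<and>
     (\<exists>(I :: 'u set) (d :: 'u \<Rightarrow> nat) f.
        diffeo X (disjoint_union_mfd (\<lambda>i. Euclidean_mfd (d i)) I) f)}"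

definition Rn_smooth :: "((nat \<Rightarrow> real) \<Rightarrow> 'u) \<Rightarrow> nat \<Rightarrow> 'u mfd" where
  "Rn_smooth c n =
     \<lparr>mtop = Rn_top c n, atlas = {(n, c ` topspace (Euclidean_space n), inv c)}\<rparr>"

end

theory Submission
  imports Defs
begin

text \<open>
  That the class of all open covers satisfies the four closure conditions is a direct verification;
  the content is that every open cover \<open>W\<close> of a space \<open>X\<close> in \<open>\<M>\<close> lies in every class \<open>C\<close> that satisfies
  them. The cover of \<open>X\<close> by its summands is disjoint, so it lies in \<open>C\<close>, and by composition,
  isomorphism invariance and coarsening it is enough to treat \<open>X = R^n\<close> (lemma \<open>C_local\<close> packages
  composition and coarsening into one local-to-global principle).

  Call a subset \<open>B\<close> of \<open>R^n\<close> good if the restriction of \<open>W\<close> to \<open>B\<close> lies in \<open>C\<close>. Each of the two sets in the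
  generating cover is a disjoint union of slabs \<open>2i < x 0 < 2i + 3\<close>, so composing with disjoint covers
  puts the cover of \<open>R^n\<close> by all these slabs into \<open>C\<close> (\<open>slabs_in_C\<close>). A box whose edges are open intervals
  is isomorphic to \<open>R^n\<close> by a map that acts on each coordinate separately and exchanges coordinates 0
  and \<open>k\<close>. Transporting the slabs shows: a box is good as soon as all the pieces are good into
  which an arbitrary parametrization of its \<open>k\<close>-th edge cuts it (\<open>C_cut_cuboid\<close>); treating the coordinates
  one after another gives the same for grids (\<open>C_cut_grid\<close>). This is used twice. With the identity
  parametrization of the line, \<open>R^n\<close> is good if all bounded boxes are. The closure of a bounded box
  is compact, hence has a Lebesgue number for \<open>W\<close>, and a sufficiently slow logistic parametrization of the
  edges cuts the box into cells below that size. Each cell lies in a single member of \<open>W\<close>, and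
  a cover that has the whole space as a member is a coarsening of the one-element cover, which is disjoint.

  Nothing in this argument distinguishes the topological from the smooth case, so it is carried out
  in the locale \<open>manifold_class\<close>. In the smooth instance no chain rule in several variables
  occurs: the isomorphisms used inside \<open>R^n\<close> act coordinatewise, and the other ones only
  rearrange given diffeomorphisms, so that their expressions in charts are restrictions of given smooth ones.
\<close>

section \<open>Smooth parametrizations of open intervals\<close>


text \<open>
  The sequence \<open>D\<close> lists the iterated derivatives; giving it explicitly turns the smoothness of a
  concrete function into one formula for all derivatives at once. The derivative at a point of
  \<open>A\<close> is two-sided.
\<close>
definition smooth_line :: "real set \<Rightarrow> (real \<Rightarrow> real) \<Rightarrow> bool" where
  "smooth_line A f \<longleftrightarrow>
     (\<exists>D. D 0 = f \<and> (\<forall>k. \<forall>x\<in>A. (D k has_real_derivative D (Suc k) x) (at x)))"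

definition line_diffeo :: "real set \<Rightarrow> (real \<Rightarrow> real) \<Rightarrow> (real \<Rightarrow> real) \<Rightarrow> bool" where
  "line_diffeo A h g \<longleftrightarrow> open A \<and> smooth_line UNIV h \<and> smooth_line A g \<and>
     (\<forall>t. h t \<in> A \<and> g (h t) = t) \<and> (\<forall>y\<in>A. h (g y) = y)"

lemma smooth_line_imp_continuous_on: "smooth_line A f \<Longrightarrow> continuous_on A f"
  unfolding smooth_line_def
  by (metis DERIV_atLeastAtMost_imp_continuous_on DERIV_continuous_on has_field_derivative_at_within)

lemma line_diffeo_id: "line_diffeo UNIV (\<lambda>t. t) (\<lambda>t. t)"
proof -
  define D :: "nat \<Rightarrow> real \<Rightarrow> real" where
    "D k = (if k = 0 then (\<lambda>t. t) else if k = 1 then (\<lambda>_. 1) else (\<lambda>_. 0))" for k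
  have "(D k has_real_derivative D (Suc k) x) (at x)" for k x
    by (auto simp: D_def)
  moreover have "D 0 = (\<lambda>t. t)" by (simp add: D_def)
  ultimately have "smooth_line UNIV (\<lambda>t. t)"
    unfolding smooth_line_def by blast
  then show ?thesis by (simp add: line_diffeo_def)
qed

definition logistic :: "real \<Rightarrow> real \<Rightarrow> real \<Rightarrow> real \<Rightarrow> real" where
  "logistic a b l t = a + (b - a) / (1 + exp (- (l * t)))"

definition logit :: "real \<Rightarrow> real \<Rightarrow> real \<Rightarrow> real \<Rightarrow> real" where
  "logit a b l y = (ln (y - a) - ln (b - y)) / l"

text \<open>
  The logistic function \<open>s\<close> satisfies \<open>s' = l (s - s^2)\<close>, so differentiation maps polynomials
  in \<open>s\<close> to polynomials in \<open>s\<close>, and iterating never leaves this class.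
\<close>
lemma smooth_line_logistic: "smooth_line UNIV (logistic a b l)"
proof -
  define s where "s t = 1 / (1 + exp (- (l * t)))" for t :: real
  define p where "p = rec_nat [:a, b - a:] (\<lambda>_ q. smult l (pderiv q * [:0, 1, - 1:]))"
  have ds: "(s has_real_derivative l * (s t - s t * s t)) (at t)" for t
  proof -
    define E where "E = exp (- (l * t))"
    have "1 + E > 0" by (simp add: E_def add_pos_pos)
    then have "l * E / (1 + E)\<^sup>2 = l * (1 / (1 + E) - 1 / (1 + E) * (1 / (1 + E)))"
      by (simp add: divide_simps) (simp add: power2_eq_square algebra_simps)
    moreover have "(s has_real_derivative l * E / (1 + E)\<^sup>2) (at t)"
      using \<open>1 + E > 0\<close> unfolding s_def E_def
      by (auto intro!: derivative_eq_intros simp: power2_eq_square)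
    ultimately show ?thesis by (simp add: s_def E_def)
  qed
  have "((\<lambda>t. poly (p k) (s t)) has_real_derivative poly (p (Suc k)) (s t)) (at t)" for k t
    using DERIV_chain2[OF poly_DERIV ds, of "p k" t]
    by (simp add: p_def algebra_simps)
  moreover have "(\<lambda>t. poly (p 0) (s t)) = logistic a b l"
    by (auto simp: p_def s_def logistic_def)
  ultimately show ?thesis
    unfolding smooth_line_def by (intro exI[of _ "\<lambda>k t. poly (p k) (s t)"]) auto
qed

lemma smooth_line_logit:
  assumes "l > 0" shows "smooth_line {a<..<b} (logit a b l)"
proof -
  define D where "D k y = (if k = 0 then logit a b l y
      else fact (k - 1) * ((- 1) ^ (k - 1) * inverse (y - a) ^ k + inverse (b - y) ^ k) / l)"
    for k :: nat and y
  have "(D k has_real_derivative D (Suc k) y) (at y)" if "y \<in> {a<..<b}" for k y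
  proof (cases k)
    case 0
    have "((\<lambda>y. (ln (y - a) - ln (b - y)) / l) has_real_derivative
        (1 / (y - a) + 1 / (b - y)) / l) (at y)"
      using that assms by (auto intro!: derivative_eq_intros)
    moreover have "D 0 = (\<lambda>y. (ln (y - a) - ln (b - y)) / l)" by (auto simp: D_def logit_def)
    ultimately show ?thesis using 0 by (simp add: D_def inverse_eq_divide)
  next
    case (Suc m)
    have D: "D k = (\<lambda>y. fact m * ((- 1) ^ m * inverse (y - a) ^ Suc m + inverse (b - y) ^ Suc m) / l)"
      "D (Suc k) y = fact (Suc m) * ((- 1) ^ Suc m * inverse (y - a) ^ Suc (Suc m) + inverse (b - y) ^ Suc (Suc m)) / l"
      using Suc by (auto simp: D_def)
    have 1: "((\<lambda>y. inverse (y - a) ^ Suc m) has_real_derivative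
        - (real (Suc m) * inverse (y - a) ^ Suc (Suc m))) (at y)"
      by (rule derivative_eq_intros refl | use that in \<open>force simp: field_simps\<close>)+
    have 2: "((\<lambda>y. inverse (b - y) ^ Suc m) has_real_derivative
        real (Suc m) * inverse (b - y) ^ Suc (Suc m)) (at y)"
      by (rule derivative_eq_intros refl | use that in \<open>force simp: field_simps\<close>)+
    show ?thesis
      unfolding D
      by (rule DERIV_cong[OF DERIV_cdivide[OF DERIV_cmult[OF DERIV_add[OF DERIV_cmult[OF 1] 2]]]])
         (simp add: algebra_simps)
  qed
  moreover have "D 0 = logit a b l" by (auto simp: D_def)
  ultimately show ?thesis unfolding smooth_line_def by blast
qed

lemma line_diffeo_logistic:
  assumes "a < b" "l > 0"
  shows "line_diffeo {a<..<b} (logistic a b l) (logit a b l)"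
proof -
  have lo: "a < logistic a b l t \<and> logistic a b l t < b \<and> logit a b l (logistic a b l t) = t" for t
  proof -
    define E where "E = exp (- (l * t))"
    have E: "E > 0" "ln E = - (l * t)" by (simp_all add: E_def)
    have 1: "logistic a b l t - a = (b - a) / (1 + E)" by (simp add: logistic_def E_def)
    have 2: "b - logistic a b l t = (b - a) * E / (1 + E)"
      using E by (simp add: logistic_def E_def[symmetric] field_simps)
    have p: "(b - a) / (1 + E) > 0" "(b - a) * E / (1 + E) > 0" using E assms by simp_all
    have "ln ((b - a) * E / (1 + E)) = ln ((b - a) / (1 + E)) + ln E"
      using E p ln_mult[of "(b - a) / (1 + E)" E] by (simp add: field_simps)
    then have "logit a b l (logistic a b l t) = t"
      using assms E by (simp add: logit_def 1 2)
    then show ?thesis using p 1 2 by linarith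
  qed
  moreover have "logistic a b l (logit a b l y) = y" if "y \<in> {a<..<b}" for y
  proof -
    have "exp (- (l * logit a b l y)) = (b - y) / (y - a)"
      using that assms by (simp add: logit_def exp_diff)
    then have "1 + exp (- (l * logit a b l y)) = (b - a) / (y - a)"
      using that by (simp add: field_simps)
    then show ?thesis using that assms by (simp add: logistic_def)
  qed
  ultimately show ?thesis
    using smooth_line_logistic smooth_line_logit[OF assms(2)] by (auto simp: line_diffeo_def)
qed

lemma logistic_strict_mono:
  assumes "a < b" "l > 0" "s < t" shows "logistic a b l s < logistic a b l t"
proof -
  have "exp (- (l * t)) < exp (- (l * s))" using assms by simp
  then have "(b - a) / (1 + exp (- (l * s))) < (b - a) / (1 + exp (- (l * t)))"
    using assms by (intro divide_strict_left_mono) (auto intro!: mult_pos_pos add_pos_pos)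
  then show ?thesis by (simp add: logistic_def)
qed

lemma logistic_less_iff:
  assumes "a < b" "l > 0" shows "logistic a b l s < logistic a b l t \<longleftrightarrow> s < t"
  using logistic_strict_mono[OF assms] by (metis less_asym' linorder_neqE_linordered_idom)

lemma logistic_image_interval:
  assumes "a < b" "l > 0"
  shows "logistic a b l ` {s<..<t} = {logistic a b l s<..<logistic a b l t}"
proof
  show "logistic a b l ` {s<..<t} \<subseteq> {logistic a b l s<..<logistic a b l t}"
    using logistic_strict_mono[OF assms] by auto
  have d: "line_diffeo {a<..<b} (logistic a b l) (logit a b l)"
    by (rule line_diffeo_logistic[OF assms])
  show "{logistic a b l s<..<logistic a b l t} \<subseteq> logistic a b l ` {s<..<t}"
  proof
    fix y assume y: "y \<in> {logistic a b l s<..<logistic a b l t}"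
    moreover have "logistic a b l s \<in> {a<..<b}" "logistic a b l t \<in> {a<..<b}"
      using d unfolding line_diffeo_def by blast+
    ultimately have "y \<in> {a<..<b}" by auto
    then have e: "y = logistic a b l (logit a b l y)" using d by (simp add: line_diffeo_def)
    then have "logit a b l y \<in> {s<..<t}"
      using y logistic_less_iff[OF assms] by (metis greaterThanLessThan_iff)
    then show "y \<in> logistic a b l ` {s<..<t}" using e by blast
  qed
qed

text \<open>Mean value theorem: with \<open>E = exp (- l t)\<close>, the derivative is \<open>(b - a) l E / (1 + E)^2\<close>, and \<open>E \<le> (1 + E)^2\<close>.\<close>
lemma logistic_diff_le:
  assumes "a < b" "l > 0" "s < t"
  shows "logistic a b l t - logistic a b l s \<le> (b - a) * l * (t - s)"
proof -
  define E where "E t = exp (- (l * t))" for t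
  have E: "E t > 0" for t by (simp add: E_def)
  have "(logistic a b l has_real_derivative (b - a) * (l * E x / (1 + E x)\<^sup>2)) (at x)" for x
  proof -
    have "1 + E x > 0" using E[of x] by simp
    then show ?thesis unfolding logistic_def[abs_def] E_def
      by (auto intro!: derivative_eq_intros simp: field_simps power2_eq_square)
  qed
  then obtain z where z: "logistic a b l t - logistic a b l s = (t - s) * ((b - a) * (l * E z / (1 + E z)\<^sup>2))"
    using MVT2[OF assms(3), of "logistic a b l" "\<lambda>x. (b - a) * (l * E x / (1 + E x)\<^sup>2)"] by blast
  have "E z \<le> (1 + E z)\<^sup>2" using E[of z] by (simp add: power2_eq_square algebra_simps)
  then have "l * E z / (1 + E z)\<^sup>2 \<le> l" using E[of z] assms
    by (simp add: divide_le_eq add_pos_pos)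
  then have "(b - a) * (t - s) * (l * E z / (1 + E z)\<^sup>2) \<le> (b - a) * (t - s) * l"
    using assms by (intro mult_left_mono) auto
  then show ?thesis unfolding z by (simp only: mult_ac)
qed

text \<open>
  Slow parametrizations of a bounded interval cut it into arbitrarily short pieces, although the
  intervals \<open>2i < t < 2i + 3\<close> of the parameter have fixed length.
\<close>
lemma fine_interval_parametrization:
  fixes a b e :: real
  assumes "a < b" "e > 0"
  obtains h g where "line_diffeo {a<..<b} h g"
    "\<And>i::int. \<exists>p q. a \<le> p \<and> p < q \<and> q \<le> b \<and> q - p < e \<and> h ` {2 * real_of_int i<..<2 * real_of_int i + 3} = {p<..<q}"
proof -
  define l where "l = e / (4 * (b - a))"
  have l: "l > 0" using assms by (simp add: l_def)
  note d = line_diffeo_logistic[OF assms(1) l]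
  have "\<exists>p q. a \<le> p \<and> p < q \<and> q \<le> b \<and> q - p < e \<and>
      logistic a b l ` {2 * real_of_int i<..<2 * real_of_int i + 3} = {p<..<q}" for i :: int
  proof (intro exI conjI)
    show "logistic a b l ` {2 * real_of_int i<..<2 * real_of_int i + 3} = {logistic a b l (2 * real_of_int i)<..<logistic a b l (2 * real_of_int i + 3)}"
      by (rule logistic_image_interval[OF assms(1) l])
    have "logistic a b l (2 * real_of_int i + 3) - logistic a b l (2 * real_of_int i) \<le> (b - a) * l * (2 * real_of_int i + 3 - 2 * real_of_int i)"
      by (rule logistic_diff_le[OF assms(1) l]) simp
    also have "(b - a) * l * (2 * real_of_int i + 3 - 2 * real_of_int i) = 3 / 4 * e" using assms by (simp add: l_def divide_simps)
    finally show "logistic a b l (2 * real_of_int i + 3) - logistic a b l (2 * real_of_int i) < e" using assms by simp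
    show "logistic a b l (2 * real_of_int i) < logistic a b l (2 * real_of_int i + 3)"
      by (rule logistic_strict_mono[OF assms(1) l]) simp
    have "logistic a b l t \<in> {a<..<b}" for t using d by (simp add: line_diffeo_def)
    then show "a \<le> logistic a b l (2 * real_of_int i)" "logistic a b l (2 * real_of_int i + 3) \<le> b"
      by (auto simp: less_imp_le)
  qed
  with d show thesis using that by blast
qed



section \<open>Boxes in Euclidean space and their coordinatewise parametrizations\<close>
definition cuboid :: "nat \<Rightarrow> (nat \<Rightarrow> real set) \<Rightarrow> (nat \<Rightarrow> real) set" where
  "cuboid n A = {x \<in> topspace (Euclidean_space n). \<forall>j<n. x j \<in> A j}"

text \<open>
  Besides reparametrizing each coordinate, the map permutes the coordinates by \<open>\<sigma>\<close>: the generating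
  covers slice \<open>R^n\<close> along coordinate 0 only, and slicing a box along coordinate \<open>k\<close> requires
  moving coordinate 0 there. The permutations used are involutions, so that the inverse is again
  of this form, with the parametrizations permuted as well.
\<close>
definition coordinate_map ::
  "nat \<Rightarrow> (nat \<Rightarrow> real \<Rightarrow> real) \<Rightarrow> (nat \<Rightarrow> nat) \<Rightarrow> (nat \<Rightarrow> real) \<Rightarrow> nat \<Rightarrow> real" where
  "coordinate_map n h \<sigma> x = (\<lambda>j. if j < n then h j (x (\<sigma> j)) else 0)"

lemma cuboid_UNIV: "cuboid n (\<lambda>_. UNIV) = topspace (Euclidean_space n)"
  by (simp add: cuboid_def)
lemma openin_cuboid:
  assumes "\<And>j. j < n \<Longrightarrow> open (A j)"
  shows "openin (Euclidean_space n) (cuboid n A)"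
proof -
  have "openin (Euclidean_space n) {x \<in> topspace (Euclidean_space n). x j \<in> A j}" if "j < n" for j
    using assms[OF that]
    by (intro openin_continuous_map_preimage[of _ euclideanreal])
       (auto simp: Euclidean_space_def intro!: continuous_map_from_subtopology continuous_map_product_coordinates)
  then have "openin (Euclidean_space n)
      (topspace (Euclidean_space n) \<inter> \<Inter>((\<lambda>j. {x \<in> topspace (Euclidean_space n). x j \<in> A j}) ` {..<n}))"
    by (intro openin_Int_Inter) auto
  moreover have "cuboid n A = topspace (Euclidean_space n) \<inter> \<Inter>((\<lambda>j. {x \<in> topspace (Euclidean_space n). x j \<in> A j}) ` {..<n})"
    by (auto simp: cuboid_def)
  ultimately show ?thesis by simp
qed

lemma continuous_map_coordinate:
  assumes "continuous_on A f" "\<And>x. x \<in> S \<Longrightarrow> x i \<in> A"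
  shows "continuous_map (subtopology (Euclidean_space n) S) euclideanreal (\<lambda>x. f (x i))"
proof -
  have 1: "continuous_map (subtopology (Euclidean_space n) S) (top_of_set A) (\<lambda>x. x i)"
    using assms(2) by (auto simp: continuous_map_in_subtopology Euclidean_space_def
        intro!: continuous_map_from_subtopology continuous_map_product_coordinates)
  have 2: "continuous_map (top_of_set A) euclideanreal f" using assms(1) by simp
  show ?thesis using continuous_map_compose[OF 1 2] by (simp add: o_def)
qed

lemma coordinate_map_inverse:
  assumes "\<forall>j<n. line_diffeo (A j) (h j) (g j)"
    and "\<forall>j<n. \<sigma> j < n \<and> \<sigma> (\<sigma> j) = j"
  shows "x \<in> topspace (Euclidean_space n) \<Longrightarrow>
      coordinate_map n h \<sigma> x \<in> cuboid n A \<and>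
      coordinate_map n (\<lambda>j. g (\<sigma> j)) \<sigma> (coordinate_map n h \<sigma> x) = x"
    and "y \<in> cuboid n A \<Longrightarrow>
      coordinate_map n (\<lambda>j. g (\<sigma> j)) \<sigma> y \<in> topspace (Euclidean_space n) \<and>
      coordinate_map n h \<sigma> (coordinate_map n (\<lambda>j. g (\<sigma> j)) \<sigma> y) = y"
proof -
  have line: "h j t \<in> A j" "g j (h j t) = t" "s \<in> A j \<Longrightarrow> h j (g j s) = s" if "j < n" for j s t
    using assms(1) that by (simp_all add: line_diffeo_def)
  have s: "\<sigma> j < n" "\<sigma> (\<sigma> j) = j" if "j < n" for j
    using assms(2) that by simp_all
  show "coordinate_map n h \<sigma> x \<in> cuboid n A \<and>
      coordinate_map n (\<lambda>j. g (\<sigma> j)) \<sigma> (coordinate_map n h \<sigma> x) = x"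
    if "x \<in> topspace (Euclidean_space n)"
    using that line s by (simp add: coordinate_map_def cuboid_def topspace_Euclidean_space fun_eq_iff)
  show "coordinate_map n (\<lambda>j. g (\<sigma> j)) \<sigma> y \<in> topspace (Euclidean_space n) \<and>
      coordinate_map n h \<sigma> (coordinate_map n (\<lambda>j. g (\<sigma> j)) \<sigma> y) = y"
    if "y \<in> cuboid n A"
    using that line s by (simp add: coordinate_map_def cuboid_def topspace_Euclidean_space fun_eq_iff)
qed

lemma homeomorphic_maps_coordinate_map:
  assumes "\<forall>j<n. line_diffeo (A j) (h j) (g j)"
    and "\<forall>j<n. \<sigma> j < n \<and> \<sigma> (\<sigma> j) = j"
  shows "homeomorphic_maps (Euclidean_space n) (subtopology (Euclidean_space n) (cuboid n A))
           (coordinate_map n h \<sigma>) (coordinate_map n (\<lambda>j. g (\<sigma> j)) \<sigma>)"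
proof -
  note inv = coordinate_map_inverse[OF assms]
  have ch: "continuous_on UNIV (h j)" "continuous_on (A j) (g j)" if "j < n" for j
    using assms(1) that by (simp_all add: line_diffeo_def smooth_line_imp_continuous_on)
  have bt: "cuboid n A \<subseteq> topspace (Euclidean_space n)" by (auto simp: cuboid_def)
  have 1: "continuous_map (Euclidean_space n) (subtopology (Euclidean_space n) (cuboid n A)) (coordinate_map n h \<sigma>)"
  proof -
    have "continuous_map (Euclidean_space n) euclideanreal (\<lambda>x. coordinate_map n h \<sigma> x j)" for j
    proof (cases "j < n")
      case True
      then show ?thesis using continuous_map_coordinate[OF ch(1)[OF True], of UNIV "\<sigma> j" n]
        by (simp add: coordinate_map_def)
    qed (simp add: coordinate_map_def)
    then have "continuous_map (Euclidean_space n) (powertop_real UNIV) (coordinate_map n h \<sigma>)"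
      by (simp add: continuous_map_componentwise_UNIV)
    then have "continuous_map (Euclidean_space n) (Euclidean_space n) (coordinate_map n h \<sigma>)"
      unfolding Euclidean_space_def[of n] continuous_map_in_subtopology
      by (auto simp: coordinate_map_def)
    then show ?thesis using inv(1) by (auto simp: continuous_map_in_subtopology)
  qed
  have 2: "continuous_map (subtopology (Euclidean_space n) (cuboid n A)) (Euclidean_space n)
      (coordinate_map n (\<lambda>j. g (\<sigma> j)) \<sigma>)"
  proof -
    have "continuous_map (subtopology (Euclidean_space n) (cuboid n A)) euclideanreal
        (\<lambda>x. coordinate_map n (\<lambda>j. g (\<sigma> j)) \<sigma> x j)" for j
    proof (cases "j < n")
      case True
      then have "\<sigma> j < n" using assms(2) by blast
      then have "continuous_map (subtopology (Euclidean_space n) (cuboid n A)) euclideanreal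
          (\<lambda>x. g (\<sigma> j) (x (\<sigma> j)))"
        by (intro continuous_map_coordinate[OF ch(2)]) (simp_all add: cuboid_def)
      then show ?thesis using True by (simp add: coordinate_map_def)
    qed (simp add: coordinate_map_def)
    then have "continuous_map (subtopology (Euclidean_space n) (cuboid n A)) (powertop_real UNIV)
        (coordinate_map n (\<lambda>j. g (\<sigma> j)) \<sigma>)"
      by (simp add: continuous_map_componentwise_UNIV)
    then show ?thesis
      unfolding Euclidean_space_def[of n] continuous_map_in_subtopology
      by (auto simp: coordinate_map_def)
  qed
  show ?thesis
    unfolding homeomorphic_maps_def using 1 2 inv by (simp add: bt inf_absorb2)
qed

lemma coordinate_map_image_slab:
  assumes "k < n" "\<forall>j<n. line_diffeo (A j) (h j) (g j)"
  shows "coordinate_map n h (Transposition.transpose 0 k) ` cuboid n ((\<lambda>_. UNIV)(0 := T)) = cuboid n (A(k := h k ` T))"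
    (is "?F ` ?B = ?C")
proof -
  let ?s = "Transposition.transpose 0 k"
  have s: "\<forall>j<n. ?s j < n \<and> ?s (?s j) = j"
    using assms(1) by (auto simp: Transposition.transpose_def)
  note inv = coordinate_map_inverse[OF assms(2) s]
  show ?thesis
  proof (intro equalityI subsetI)
    fix y assume "y \<in> ?F ` ?B"
    then obtain x where x: "x \<in> ?B" "y = ?F x" by auto
    have "0 < n" using assms(1) by simp
    then have "x 0 \<in> T" using x(1) unfolding cuboid_def by force
    moreover have "y k = h k (x 0)"
      using assms(1) unfolding x(2) by (simp add: coordinate_map_def)
    moreover have "y \<in> cuboid n A"
      unfolding x(2) using inv(1)[of x] x(1) by (simp add: cuboid_def)
    ultimately show "y \<in> ?C" by (simp add: cuboid_def)
  next
    fix y assume y: "y \<in> ?C"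
    have hk: "h k t \<in> A k" "g k (h k t) = t" for t
      using assms by (simp_all add: line_diffeo_def)
    have yk: "y k \<in> h k ` T" using y assms(1) unfolding cuboid_def by force
    have yA: "y \<in> cuboid n A"
      unfolding cuboid_def
    proof (intro CollectI conjI allI impI)
      show "y \<in> topspace (Euclidean_space n)" using y by (simp add: cuboid_def)
      fix j assume "j < n"
      show "y j \<in> A j"
      proof (cases "j = k")
        case True
        then show ?thesis using yk hk(1) by auto
      next
        case False
        then show ?thesis using y \<open>j < n\<close> unfolding cuboid_def by force
      qed
    qed
    let ?x = "coordinate_map n (\<lambda>j. g (?s j)) ?s y"
    have "g k (y k) \<in> T" using yk hk(2) by auto
    moreover have "?x 0 = g k (y k)" using assms(1) by (simp add: coordinate_map_def)
    ultimately have "?x \<in> ?B" using inv(2)[OF yA] by (simp add: cuboid_def)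
    then show "y \<in> ?F ` ?B" using inv(2)[OF yA] by (metis imageI)
  qed
qed

text \<open>
  The components of the two generating sets: even indices give the first set, odd indices the second.
\<close>
definition slab :: "nat \<Rightarrow> int \<Rightarrow> (nat \<Rightarrow> real) set" where
  "slab n i = cuboid n ((\<lambda>_. UNIV)(0 := {2 * real_of_int i<..<2 * real_of_int i + 3}))"

lemma mem_slab_iff:
  "n \<ge> 1 \<Longrightarrow> x \<in> slab n i \<longleftrightarrow>
     x \<in> topspace (Euclidean_space n) \<and> x 0 \<in> {2 * real_of_int i<..<2 * real_of_int i + 3}"
  by (auto simp: slab_def cuboid_def)

lemma stripes_U_eq_slabs: "n \<ge> 1 \<Longrightarrow> stripes_U n = (\<Union>i. slab n (2 * i))"
  by (auto simp: stripes_U_def mem_slab_iff)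

lemma stripes_V_eq_slabs: "n \<ge> 1 \<Longrightarrow> stripes_V n = (\<Union>i. slab n (2 * i + 1))"
  by (auto simp: stripes_V_def mem_slab_iff algebra_simps)

lemma slabs_disjoint:
  assumes "n \<ge> 1" "i \<noteq> j" "even (i - j)"
  shows "slab n i \<inter> slab n j = {}"
proof -
  obtain m where m: "i = j + 2 * m" using assms(3) by (metis add_diff_cancel_left' dvdE add.commute diff_add_cancel)
  then have "m \<le> -1 \<or> m \<ge> 1" using assms(2) by auto
  then have "real_of_int i \<le> real_of_int j - 2 \<or> real_of_int i \<ge> real_of_int j + 2" using m by auto
  then show ?thesis by (auto simp: mem_slab_iff[OF assms(1)])
qed

lemma slabs_cover: "n \<ge> 1 \<Longrightarrow> (\<Union>i. slab n i) = topspace (Euclidean_space n)"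
proof (intro equalityI subsetI)
  fix x assume n: "n \<ge> 1" and x: "x \<in> topspace (Euclidean_space n)"
  define i where "i = \<lceil>x 0 / 2\<rceil> - 1"
  have "x 0 / 2 \<le> real_of_int i + 1" "x 0 / 2 > real_of_int i" by (simp_all add: i_def) linarith+
  then have "x \<in> slab n i" using n x by (simp add: mem_slab_iff)
  then show "x \<in> (\<Union>i. slab n i)" by blast
qed (auto simp: mem_slab_iff)

lemma stripes_cover:
  assumes "n \<ge> 1" shows "stripes_U n \<union> stripes_V n = topspace (Euclidean_space n)"
proof (intro equalityI subsetI)
  fix x assume "x \<in> topspace (Euclidean_space n)"
  then obtain i where i: "x \<in> slab n i" using slabs_cover[OF assms] by (metis UN_E)
  consider m where "i = 2 * m" | m where "i = 2 * m + 1" by (metis evenE oddE)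
  then show "x \<in> stripes_U n \<union> stripes_V n"
  proof cases
    case 1
    then show ?thesis using i unfolding stripes_U_eq_slabs[OF assms] by (intro UnI1 UN_I[of m]) auto
  next
    case 2
    then show ?thesis using i unfolding stripes_V_eq_slabs[OF assms] by (intro UnI2 UN_I[of m]) auto
  qed
qed (auto simp: stripes_U_def stripes_V_def)

lemma topspace_Rn_top: "inj c \<Longrightarrow> topspace (Rn_top c n) = c ` topspace (Euclidean_space n)"
  by (auto simp: Rn_top_def topspace_pullback_topology)

lemma openin_Rn_top:
  "inj c \<Longrightarrow> openin (Rn_top c n) S \<longleftrightarrow> (\<exists>T. openin (Euclidean_space n) T \<and> S = c ` T)"
proof -
  assume c: "inj c"
  have "inv c -` T \<inter> c ` topspace (Euclidean_space n) = c ` T" if "openin (Euclidean_space n) T" for T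
    using openin_subset[OF that] c by (auto simp: image_iff)
  then show ?thesis unfolding Rn_top_def openin_pullback_topology by metis
qed

lemma openin_Rn_top_image:
  "inj c \<Longrightarrow> openin (Euclidean_space n) T \<Longrightarrow> openin (Rn_top c n) (c ` T)"
  unfolding openin_Rn_top by blast

lemma homeomorphic_maps_Rn_top:
  "inj c \<Longrightarrow> homeomorphic_maps (Euclidean_space n) (Rn_top c n) c (inv c)"
proof -
  assume c: "inj c"
  have *: "{x \<in> topspace (Euclidean_space n). c x \<in> c ` T} = T" if "openin (Euclidean_space n) T" for T
    using openin_subset[OF that] c by (auto simp: inj_image_mem_iff)
  have **: "{x \<in> c ` topspace (Euclidean_space n). inv c x \<in> T} = c ` T" if "openin (Euclidean_space n) T" for T
    using openin_subset[OF that] c by auto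
  show ?thesis
    unfolding homeomorphic_maps_def continuous_map_def
    using c by (auto simp: openin_Rn_top topspace_Rn_top * **)
qed

text \<open>
  The metric on \<open>nat \<Rightarrow> real\<close> is a weighted sum of truncated coordinate distances whose weights add up to 2.
\<close>
lemma dist_fun_le_of_coordinates:
  fixes x y :: "nat \<Rightarrow> real"
  assumes "\<And>i. dist (x i) (y i) \<le> d"
  shows "dist x y \<le> 2 * d"
proof (rule field_le_epsilon)
  fix e :: real assume "e > 0"
  then obtain N where N: "(1/2 :: real) ^ N < e" using real_arch_pow_inv[of e "1/2"] by auto
  have "Max {dist (x (from_nat n)) (y (from_nat n))|n. n \<le> N} \<le> d"
    using assms by (subst Max_le_iff) auto
  then show "dist x y \<le> 2 * d + e"
    using dist_fun_le_dist_first_terms[of x y N] N by linarith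
qed

lemma compact_closed_cuboid:
  fixes a b :: "nat \<Rightarrow> real"
  shows "compact {x :: nat \<Rightarrow> real. \<forall>j. x j \<in> {a j..b j}}"
proof -
  have "compactin (powertop_real UNIV) (PiE UNIV (\<lambda>j. {a j..b j}))"
    by (simp add: compactin_PiE)
  moreover have "PiE UNIV (\<lambda>j. {a j..b j}) = {x :: nat \<Rightarrow> real. \<forall>j. x j \<in> {a j..b j}}"
    by auto
  ultimately show ?thesis by (simp add: euclidean_product_topology)
qed




section \<open>The argument common to topological and smooth manifolds\<close>

text \<open>
  The predicate \<open>wellformed\<close> separates the local condition on a space (trivial for topological
  spaces, being a smooth manifold in the smooth case) from the decomposition into copies of
  \<open>R^n\<close>. The last assumption replaces abstract disjoint unions by internal ones: a space is
  in the class iff it has a disjoint open cover by isomorphic copies of Euclidean spaces.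
\<close>
locale manifold_class =
  fixes tp :: "'s \<Rightarrow> 'u topology"
    and sub :: "'s \<Rightarrow> 'u set \<Rightarrow> 's"
    and isom :: "'s \<Rightarrow> 's \<Rightarrow> ('u \<Rightarrow> 'u) \<Rightarrow> bool"
    and Rn :: "nat \<Rightarrow> 's"
    and c :: "(nat \<Rightarrow> real) \<Rightarrow> 'u"
    and M :: "'s set"
    and wellformed :: "'s \<Rightarrow> bool"
  assumes inj_c: "inj c"
    and tp_Rn: "tp (Rn n) = Rn_top c n"
    and tp_sub: "tp (sub X W) = subtopology (tp X) W"
    and sub_sub: "sub (sub X W) W' = sub X (W \<inter> W')"
    and sub_topspace: "wellformed X \<Longrightarrow> sub X (topspace (tp X)) = X"
    and wellformed_Rn: "wellformed (Rn n)"
    and wellformed_sub: "wellformed X \<Longrightarrow> openin (tp X) W \<Longrightarrow> wellformed (sub X W)"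
    and isom_imp_homeomorphic_map: "isom X Y f \<Longrightarrow> homeomorphic_map (tp X) (tp Y) f"
    and isom_cuboid:
      "\<lbrakk>\<forall>j<n. line_diffeo (A j) (h j) (g j); \<forall>j<n. \<sigma> j < n \<and> \<sigma> (\<sigma> j) = j\<rbrakk> \<Longrightarrow>
       isom (Rn n) (sub (Rn n) (c ` cuboid n A)) (c \<circ> coordinate_map n h \<sigma> \<circ> inv c)"
    and M_iff:
      "X \<in> M \<longleftrightarrow> wellformed X \<and>
         (\<exists>(I :: 'u set) U d g. open_cover (tp X) I U \<and> disjoint_family_on U I \<and>
            (\<forall>i\<in>I. isom (Rn (d i)) (sub X (U i)) (g i)))"
begin

lemma M_wellformed: "X \<in> M \<Longrightarrow> wellformed X"
  by (simp add: M_iff)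

text \<open>
  Composition can only be applied at a member of a cover that is itself in the class. This lemma
  provides that for the disjoint unions of slabs, and for single boxes.
\<close>
lemma disjoint_cuboids_in_M:
  assumes line: "\<And>i j. i \<in> I \<Longrightarrow> j < n \<Longrightarrow> \<exists>h g. line_diffeo (A i j) h g"
    and disj: "disjoint_family_on (\<lambda>i. cuboid n (A i)) (I :: 'u set)"
  shows "sub (Rn n) (c ` (\<Union>i\<in>I. cuboid n (A i))) \<in> M"
    and "open_cover (tp (sub (Rn n) (c ` (\<Union>i\<in>I. cuboid n (A i))))) I (\<lambda>i. c ` cuboid n (A i))"
    and "disjoint_family_on (\<lambda>i. c ` cuboid n (A i)) I"
proof -
  let ?S = "c ` (\<Union>i\<in>I. cuboid n (A i))"
  have "openin (Euclidean_space n) (cuboid n (A i))" if "i \<in> I" for i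
    using line[OF that] by (intro openin_cuboid) (auto simp: line_diffeo_def)
  then have op: "openin (tp (Rn n)) (c ` cuboid n (A i))" if "i \<in> I" for i
    using that inj_c by (auto simp: tp_Rn openin_Rn_top)
  then have opS: "openin (tp (Rn n)) ?S" by (auto simp: image_UN)
  have sub: "c ` cuboid n (A i) \<subseteq> ?S" if "i \<in> I" for i using that by auto
  show cov: "open_cover (tp (sub (Rn n) ?S)) I (\<lambda>i. c ` cuboid n (A i))"
    unfolding open_cover_def tp_sub
  proof (intro conjI ballI)
    show "openin (subtopology (tp (Rn n)) ?S) (c ` cuboid n (A i))" if "i \<in> I" for i
      using op[OF that] sub[OF that] by (simp add: openin_open_subtopology[OF opS])
    have "?S \<subseteq> topspace (tp (Rn n))" by (rule openin_subset[OF opS])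
    then show "(\<Union>i\<in>I. c ` cuboid n (A i)) = topspace (subtopology (tp (Rn n)) ?S)"
      by auto
  qed
  show dj: "disjoint_family_on (\<lambda>i. c ` cuboid n (A i)) I"
    using disj inj_c unfolding disjoint_family_on_def by (simp add: image_Int[symmetric])
  have "\<exists>g. isom (Rn n) (sub (sub (Rn n) ?S) (c ` cuboid n (A i))) g" if i: "i \<in> I" for i
  proof -
    obtain h g where hg: "\<forall>j<n. line_diffeo (A i j) (h j) (g j)"
      using line[OF i] by metis
    have "sub (sub (Rn n) ?S) (c ` cuboid n (A i)) = sub (Rn n) (c ` cuboid n (A i))"
      using sub[OF i] by (simp only: sub_sub inf_absorb2)
    then show ?thesis
      using isom_cuboid[OF hg, of "\<lambda>j. j"] by auto
  qed
  then obtain g where "\<forall>i\<in>I. isom (Rn n) (sub (sub (Rn n) ?S) (c ` cuboid n (A i))) (g i)"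
    by metis
  moreover have "wellformed (sub (Rn n) ?S)" by (rule wellformed_sub[OF wellformed_Rn opS])
  ultimately show "sub (Rn n) ?S \<in> M"
    using cov dj by (subst M_iff) (auto intro!: exI[of _ I] exI[of _ "\<lambda>i. c ` cuboid n (A i)"] exI[of _ "\<lambda>_. n"])
qed

lemma cuboid_in_M:
  assumes "\<And>j. j < n \<Longrightarrow> \<exists>h g. line_diffeo (A j) h g"
  shows "sub (Rn n) (c ` cuboid n A) \<in> M"
proof -
  have "sub (Rn n) (c ` (\<Union>i\<in>{undefined :: 'u}. cuboid n A)) \<in> M"
    by (rule disjoint_cuboids_in_M(1)[of "{undefined}" n "\<lambda>_. A"])
       (simp_all add: assms disjoint_family_on_def)
  then show ?thesis by simp
qed

lemma sub_Rn_whole: "sub (Rn n) (c ` topspace (Euclidean_space n)) = Rn n"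
  using sub_topspace[OF wellformed_Rn] by (simp add: tp_Rn topspace_Rn_top[OF inj_c])

lemma Rn_in_M: "Rn n \<in> M"
  using cuboid_in_M[of n "\<lambda>_. UNIV"] line_diffeo_id by (auto simp: cuboid_UNIV sub_Rn_whole)

text \<open>
  Composition needs the pairs of indices encoded in the universe, which is possible because the
  universe contains a copy of the reals and so is infinite.
\<close>
lemma ex_pairing_bijection: "\<exists>p :: 'u \<Rightarrow> 'u \<times> 'u. bij p"
proof -
  have "infinite (UNIV :: (nat \<Rightarrow> real) set)"
  proof
    assume "finite (UNIV :: (nat \<Rightarrow> real) set)"
    then have "finite (range (\<lambda>(t::real) (_::nat). t))" by (rule finite_subset[rotated]) simp
    then have "finite (UNIV :: real set)" by (rule finite_imageD) (auto simp: inj_on_def fun_eq_iff)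
    then show False using infinite_UNIV_char_0 by blast
  qed
  then have "infinite (range c)" using inj_c finite_imageD by blast
  then have "infinite (UNIV :: 'u set)" using finite_subset subset_UNIV by blast
  then obtain q :: "'u \<times> 'u \<Rightarrow> 'u" where "bij_betw q (UNIV \<times> UNIV) UNIV"
    using card_of_Times_same_infinite[of "UNIV :: 'u set"] unfolding card_of_ordIso[symmetric] by blast
  then have "bij_betw (inv_into (UNIV \<times> UNIV) q) UNIV (UNIV \<times> UNIV)" by (rule bij_betw_inv_into)
  then show ?thesis by (metis UNIV_Times_UNIV)
qed

lemma admissible_all_covers: "admissible tp sub isom Rn c M (all_covers tp M)"
  unfolding admissible_def
proof (intro conjI)
  show "all_covers tp M \<subseteq> all_covers tp M" by simp
  show "contains_disjoint tp M (all_covers tp M)"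
    by (simp add: contains_disjoint_def all_covers_def)
  show "coarsening_closed tp M (all_covers tp M)"
    by (simp add: coarsening_closed_def all_covers_def)
  show "contains_stripes Rn c (all_covers tp M)"
    unfolding contains_stripes_def all_covers_def
  proof clarsimp
    fix n :: nat and a b :: 'u assume n: "Suc 0 \<le> n" and ab: "a \<noteq> b"
    have op: "openin (Euclidean_space n) (slab n i)" for i
      unfolding slab_def by (rule openin_cuboid) auto
    have "openin (Euclidean_space n) (\<Union>i. slab n (f i))" for f :: "int \<Rightarrow> int"
      using op by (intro openin_Union) auto
    then have "openin (Rn_top c n) (c ` (\<Union>i. slab n (f i)))" for f :: "int \<Rightarrow> int"
      by (rule openin_Rn_top_image[OF inj_c])
    then have "openin (Rn_top c n) (c ` stripes_U n)" "openin (Rn_top c n) (c ` stripes_V n)"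
      using n by (simp_all only: stripes_U_eq_slabs stripes_V_eq_slabs One_nat_def)
    moreover have "stripes_V n \<union> stripes_U n = topspace (Euclidean_space n)"
      using n by (simp add: stripes_cover Un_commute)
    ultimately show "Rn n \<in> M \<and>
        open_cover (tp (Rn n)) {a, b} (\<lambda>i. if i = a then c ` stripes_U n else c ` stripes_V n)"
      using ab Rn_in_M by (simp add: open_cover_def tp_Rn topspace_Rn_top[OF inj_c] image_Un[symmetric])
  qed
  show "iso_closed isom M (all_covers tp M)"
    unfolding iso_closed_def all_covers_def
  proof clarsimp
    fix X Y I f and U :: "'u \<Rightarrow> 'u set"
    assume U: "open_cover (tp X) I U" and "isom X Y f"
    then have f: "homeomorphic_map (tp X) (tp Y) f" by (intro isom_imp_homeomorphic_map)
    have "openin (tp Y) (f ` U i)" if "i \<in> I" for i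
      using homeomorphic_imp_open_map[OF f] U that by (simp add: open_map_def open_cover_def)
    moreover have "(\<Union>i\<in>I. f ` U i) = topspace (tp Y)"
      using U homeomorphic_imp_surjective_map[OF f] by (simp add: image_UN[symmetric] open_cover_def)
    ultimately show "open_cover (tp Y) I (\<lambda>i. f ` U i)" by (simp add: open_cover_def)
  qed
  show "composition_closed sub (all_covers tp M)"
    unfolding composition_closed_def all_covers_def
  proof clarsimp
    fix X I and U :: "'u \<Rightarrow> 'u set" and J and V :: "'u \<Rightarrow> 'u \<Rightarrow> 'u set" and K p
    assume U: "open_cover (tp X) I U"
      and V: "\<forall>i\<in>I. sub X (U i) \<in> M \<and> open_cover (tp (sub X (U i))) (J i) (V i)"
      and p: "bij_betw p K (Sigma I J)"
    have U_open: "openin (tp X) (U i)" if "i \<in> I" for i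
      using U that by (simp add: open_cover_def)
    have V_cover: "open_cover (subtopology (tp X) (U i)) (J i) (V i)" if "i \<in> I" for i
      using V that by (simp add: tp_sub)
    have op: "openin (tp X) (V i j)" if "i \<in> I" "j \<in> J i" for i j
      using V_cover[OF that(1)] that(2) openin_trans_full[OF _ U_open[OF that(1)]]
      by (simp add: open_cover_def)
    have un: "(\<Union>j\<in>J i. V i j) = U i" if "i \<in> I" for i
      using V_cover[OF that] openin_subset[OF U_open[OF that]]
      by (simp add: open_cover_def inf_absorb2)
    have "(\<Union>k\<in>K. V (fst (p k)) (snd (p k))) = (\<Union>x\<in>p ` K. V (fst x) (snd x))" by simp
    also have "\<dots> = (\<Union>i\<in>I. \<Union>j\<in>J i. V i j)"
      unfolding bij_betw_imp_surj_on[OF p] Sigma_def by simp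
    also have "\<dots> = topspace (tp X)" using un U by (simp add: open_cover_def)
    finally have un_K: "(\<Union>k\<in>K. V (fst (p k)) (snd (p k))) = topspace (tp X)" .
    have "openin (tp X) (V (fst (p k)) (snd (p k)))" if "k \<in> K" for k
    proof -
      have "p k \<in> Sigma I J" using p that bij_betwE by blast
      then show ?thesis by (intro op) (auto simp: mem_Sigma_iff split: prod.splits)
    qed
    then show "open_cover (tp X) K (\<lambda>k. V (fst (p k)) (snd (p k)))"
      using un_K by (simp add: open_cover_def)
  qed
qed


lemma open_cover_restrict:
  assumes "open_cover (tp X) J W" "S \<subseteq> topspace (tp X)"
  shows "open_cover (tp (sub X S)) J (\<lambda>j. W j \<inter> S)"
proof -
  have "(\<Union>j\<in>J. W j \<inter> S) = (\<Union>j\<in>J. W j) \<inter> S" by simp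
  then show ?thesis
    using assms unfolding open_cover_def tp_sub by (simp add: openin_subtopology_Int inf_absorb2)
qed

abbreviation int_index :: "int \<Rightarrow> 'u" where "int_index i \<equiv> c (\<lambda>_. real_of_int i)"

lemma inj_int_index: "inj int_index"
  by (rule injI) (metis inj_c injD of_int_eq_iff)

context
  fixes C assumes C: "admissible tp sub isom Rn c M C"
begin

lemma C_subset: "(X, I, U) \<in> C \<Longrightarrow> X \<in> M \<and> open_cover (tp X) I U"
  using C by (auto simp: admissible_def all_covers_def)

lemma C_coarsen:
  assumes XI: "(X, I, U) \<in> C" and W: "open_cover (tp X) J W" and "refines I U J W"
  shows "(X, J, W) \<in> C"
  using C C_subset[OF XI] assms unfolding admissible_def coarsening_closed_def by blast

lemma C_if_disjoint_refinement:
  assumes X: "X \<in> M" and W: "open_cover (tp X) J W" and D: "open_cover (tp X) (I :: 'u set) D"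
    and disj: "disjoint_family_on D I" and "refines I D J W"
  shows "(X, J, W) \<in> C"
proof -
  have "(X, I, D) \<in> C"
    using C X D disj unfolding admissible_def contains_disjoint_def by blast
  then show ?thesis using W \<open>refines I D J W\<close> by (rule C_coarsen)
qed

text \<open>This is how the subdivision ends: a cell contained in one member of the cover is good.\<close>
lemma C_if_whole_space_member:
  assumes "X \<in> M" "open_cover (tp X) J W" "j \<in> J" "topspace (tp X) \<subseteq> W j"
  shows "(X, J, W) \<in> C"
proof (rule C_if_disjoint_refinement[OF assms(1,2)])
  show "open_cover (tp X) {j} (\<lambda>_. topspace (tp X))" by (simp add: open_cover_def)
  show "disjoint_family_on (\<lambda>_. topspace (tp X)) {j}" by (simp add: disjoint_family_on_def)
  show "refines {j} (\<lambda>_. topspace (tp X)) J W"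
    using assms(3,4) unfolding refines_def by blast
qed

text \<open>
  Composition yields the family of all \<open>W j \<inter> U i\<close>, which refines \<open>W\<close>. So membership of a cover in
  \<open>C\<close> may be tested on the members of a cover that is already known to be in \<open>C\<close>.
\<close>
lemma C_local:
  assumes U: "(X, I, U) \<in> C" and W: "open_cover (tp X) J W"
    and loc: "\<And>i. i \<in> I \<Longrightarrow> (sub X (U i), J, \<lambda>j. W j \<inter> U i) \<in> C"
  shows "(X, J, W) \<in> C"
proof -
  obtain p :: "'u \<Rightarrow> 'u \<times> 'u" where p: "bij p" using ex_pairing_bijection by blast
  define K where "K = p -` (I \<times> J)"
  have K: "bij_betw p K (SIGMA i:I. J)"
    using p inj_on_subset[of p UNIV] unfolding K_def bij_betw_def
    by (simp add: surj_image_vimage_eq)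
  have comp: "composition_closed sub C" using C by (simp add: admissible_def)
  have K': "(X, K, \<lambda>k. W (snd (p k)) \<inter> U (fst (p k))) \<in> C"
    using comp[unfolded composition_closed_def, rule_format, of X I U "\<lambda>_. J" "\<lambda>i j. W j \<inter> U i" p K]
      U loc K by blast
  have "refines K (\<lambda>k. W (snd (p k)) \<inter> U (fst (p k))) J W"
    unfolding refines_def
  proof
    fix k assume "k \<in> K"
    then have "snd (p k) \<in> J" by (auto simp: K_def)
    then show "\<exists>j\<in>J. W (snd (p k)) \<inter> U (fst (p k)) \<subseteq> W j" by blast
  qed
  with K' W show ?thesis by (rule C_coarsen)
qed

lemma C_image_isom:
  assumes XI: "(X, I, U) \<in> C" and f: "isom X Y f" and Y: "Y \<in> M"
  shows "(Y, I, \<lambda>i. f ` U i) \<in> C"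
proof -
  have "iso_closed isom M C" using C by (simp add: admissible_def)
  moreover have "X \<in> M" using C_subset[OF XI] by simp
  ultimately show ?thesis
    using XI f Y unfolding iso_closed_def by blast
qed

text \<open>
  On each of the two generating sets the slabs restrict to a cover that is refined by the disjoint
  cover consisting of the components of this set.
\<close>
lemma slabs_in_C:
  assumes n: "n \<ge> 1"
  shows "(Rn n, range int_index, \<lambda>u. c ` slab n (inv int_index u)) \<in> C"
proof -
  let ?W = "\<lambda>u. c ` slab n (inv int_index u)"
  have W_index: "?W (int_index i) = c ` slab n i" for i
    using inv_f_f[OF inj_int_index] by simp
  have line: "\<exists>h g. line_diffeo (((\<lambda>_. UNIV)(0 := {2 * real_of_int i<..<2 * real_of_int i + 3})) j) h g" for i and j :: nat
    using line_diffeo_id line_diffeo_logistic[of "2 * real_of_int i" "2 * real_of_int i + 3" 1]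
    by (cases "j = 0") auto
  have op: "openin (Euclidean_space n) (slab n i)" for i
      unfolding slab_def by (rule openin_cuboid) auto
  have W: "open_cover (tp (Rn n)) (range int_index) ?W"
    unfolding open_cover_def tp_Rn topspace_Rn_top[OF inj_c]
  proof (intro conjI ballI)
    show "openin (Rn_top c n) (?W u)" for u using op inj_c by (auto simp: openin_Rn_top)
    have "(\<Union>u\<in>range int_index. ?W u) = c ` (\<Union>i. slab n i)"
      using W_index by (simp add: image_UN)
    then show "(\<Union>u\<in>range int_index. ?W u) = c ` topspace (Euclidean_space n)"
      by (simp add: slabs_cover[OF n])
  qed
  \<comment> \<open>\<open>r = 0\<close> gives the first generating set, \<open>r = 1\<close> the second.\<close>
  have stripe: "(sub (Rn n) (c ` (\<Union>i. slab n (2 * i + r))), range int_index,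
      \<lambda>u. ?W u \<inter> c ` (\<Union>i. slab n (2 * i + r))) \<in> C" (is "(_, _, ?WS) \<in> C") for r
  proof -
    let ?A = "\<lambda>u. ((\<lambda>_. UNIV)(0 := {2 * real_of_int (2 * inv int_index u + r)<..<2 * real_of_int (2 * inv int_index u + r) + 3})) :: nat \<Rightarrow> real set"
    let ?S = "c ` (\<Union>i. slab n (2 * i + r))"
    have A: "cuboid n (?A u) = slab n (2 * inv int_index u + r)" for u by (simp add: slab_def)
    have S: "(\<Union>u\<in>range int_index. cuboid n (?A u)) = (\<Union>i. slab n (2 * i + r))"
      unfolding A by (simp add: inv_f_f[OF inj_int_index])
    have disj: "disjoint_family_on (\<lambda>u. cuboid n (?A u)) (range int_index)"
      unfolding disjoint_family_on_def A
    proof (intro ballI impI)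
      fix u v assume "u \<in> range int_index" "v \<in> range int_index" "u \<noteq> v"
      then have "inv int_index u \<noteq> inv int_index v"
        using f_inv_into_f[of u int_index UNIV] f_inv_into_f[of v int_index UNIV] by auto
      then show "slab n (2 * inv int_index u + r) \<inter> slab n (2 * inv int_index v + r) = {}"
        by (intro slabs_disjoint[OF n]) auto
    qed
    note * = disjoint_cuboids_in_M[of "range int_index" n ?A, OF line disj, unfolded S]
    have Ssub: "?S \<subseteq> topspace (tp (Rn n))"
      unfolding tp_Rn topspace_Rn_top[OF inj_c]
      by (intro image_mono UN_least openin_subset op)
    have "refines (range int_index) (\<lambda>u. c ` cuboid n (?A u)) (range int_index) ?WS"
      unfolding refines_def
    proof
      fix u assume "u \<in> range int_index"
      then obtain i where u: "u = int_index i" by auto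
      have "slab n (2 * i + r) \<subseteq> (\<Union>i. slab n (2 * i + r))" by (rule UN_upper) simp
      moreover have "cuboid n (?A u) = slab n (2 * i + r)"
        using A[of u] by (simp only: u inv_f_f[OF inj_int_index])
      ultimately have "c ` cuboid n (?A u) \<subseteq> ?WS (int_index (2 * i + r))"
        unfolding W_index by (simp add: image_mono)
      then show "\<exists>v\<in>range int_index. c ` cuboid n (?A u) \<subseteq> ?WS v" by blast
    qed
    then show ?thesis
      using C_if_disjoint_refinement[OF *(1) open_cover_restrict[OF W Ssub] *(2,3)] by blast
  qed
  have "int_index 0 \<noteq> int_index 1" using injD[OF inj_int_index, of 0 1] by auto
  then obtain a b :: 'u where ab: "a \<noteq> b" by blast
  have "contains_stripes Rn c C" using C by (simp add: admissible_def)
  then have "(Rn n, {a, b}, \<lambda>i. if i = a then c ` stripes_U n else c ` stripes_V n) \<in> C"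
    using n ab by (simp add: contains_stripes_def)
  then show ?thesis
  proof (rule C_local[OF _ W])
    fix i
    show "(sub (Rn n) (if i = a then c ` stripes_U n else c ` stripes_V n), range int_index,
        \<lambda>u. ?W u \<inter> (if i = a then c ` stripes_U n else c ` stripes_V n)) \<in> C"
      using stripe[of 0] stripe[of 1] by (simp add: stripes_U_eq_slabs[OF n] stripes_V_eq_slabs[OF n])
  qed
qed

text \<open>
  The parametrization of the box \<open>A\<close> that exchanges coordinates 0 and \<open>k\<close> carries the slabs of \<open>R^n\<close> to
  the pieces of \<open>A\<close>, so the cover of \<open>A\<close> by its pieces lies in \<open>C\<close>.
\<close>
lemma C_cut_cuboid:
  assumes W: "open_cover (tp (Rn n)) J W" and k: "k < n"
    and line: "\<forall>j<n. line_diffeo (A j) (h j) (g j)"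
    and pieces: "\<And>i. (sub (Rn n) (c ` cuboid n (A(k := h k ` {2 * real_of_int i<..<2 * real_of_int i + 3}))), J,
        \<lambda>j. W j \<inter> c ` cuboid n (A(k := h k ` {2 * real_of_int i<..<2 * real_of_int i + 3}))) \<in> C"
  shows "(sub (Rn n) (c ` cuboid n A), J, \<lambda>j. W j \<inter> c ` cuboid n A) \<in> C"
proof -
  let ?s = "Transposition.transpose 0 k"
  let ?F = "c \<circ> coordinate_map n h ?s \<circ> inv c"
  let ?P = "\<lambda>i. cuboid n (A(k := h k ` {2 * real_of_int i<..<2 * real_of_int i + 3}))"
  have s: "\<forall>j<n. ?s j < n \<and> ?s (?s j) = j"
    using k by (auto simp: Transposition.transpose_def)
  have iso: "isom (Rn n) (sub (Rn n) (c ` cuboid n A)) ?F"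
    by (rule isom_cuboid[OF line s])
  have M: "sub (Rn n) (c ` cuboid n A) \<in> M" using line by (intro cuboid_in_M) blast
  have "?F ` c ` S = c ` coordinate_map n h ?s ` S" for S
    by (simp add: image_image inj_c)
  then have F: "?F ` c ` slab n i = c ` ?P i" for i
    unfolding slab_def using coordinate_map_image_slab[OF k line] by simp
  have "(sub (Rn n) (c ` cuboid n A), range int_index, \<lambda>u. ?F ` c ` slab n (inv int_index u)) \<in> C"
    using k by (intro C_image_isom[OF slabs_in_C iso M]) simp
  then have "(sub (Rn n) (c ` cuboid n A), range int_index, \<lambda>u. c ` ?P (inv int_index u)) \<in> C"
    unfolding F .
  then show ?thesis
  proof (rule C_local)
    have "openin (Euclidean_space n) (cuboid n A)"
      using line by (intro openin_cuboid) (auto simp: line_diffeo_def)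
    then have "c ` cuboid n A \<subseteq> topspace (tp (Rn n))"
      using openin_subset by (fastforce simp: tp_Rn topspace_Rn_top[OF inj_c])
    then show "open_cover (tp (sub (Rn n) (c ` cuboid n A))) J (\<lambda>j. W j \<inter> c ` cuboid n A)"
      by (rule open_cover_restrict[OF W])
    fix u
    let ?i = "inv int_index u"
    have "h k t \<in> A k" for t
      using line k by (simp add: line_diffeo_def)
    then have "?P ?i \<subseteq> cuboid n A"
      unfolding cuboid_def by (intro subsetI CollectI conjI allI impI) (auto split: if_splits)
    then have "c ` cuboid n A \<inter> c ` ?P ?i = c ` ?P ?i" by blast
    then show "(sub (sub (Rn n) (c ` cuboid n A)) (c ` ?P ?i), J, \<lambda>j. W j \<inter> c ` cuboid n A \<inter> c ` ?P ?i) \<in> C"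
      using pieces[of ?i] by (simp add: sub_sub Int_assoc)
  qed
qed

text \<open>
  The coordinates are cut one after another: the downward induction on \<open>m\<close> treats the boxes
  in which the first \<open>m\<close> edges already are pieces from \<open>P\<close> and the other edges are still those of \<open>A\<close>.
  The cut edges of such an intermediate box need parametrizations as well, which is why
  the members of \<open>P\<close> have to be parametrizable.
\<close>
lemma C_cut_grid:
  assumes W: "open_cover (tp (Rn n)) J W"
    and line: "\<forall>j<n. line_diffeo (A j) (h j) (g j)"
    and pieces: "\<And>j i. j < n \<Longrightarrow> h j ` {2 * real_of_int i<..<2 * real_of_int i + 3} \<in> P j"
    and P_line: "\<And>j S. j < n \<Longrightarrow> S \<in> P j \<Longrightarrow> \<exists>h g. line_diffeo S h g"
    and cells: "\<And>S. (\<And>j. j < n \<Longrightarrow> S j \<in> P j) \<Longrightarrow>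
        (sub (Rn n) (c ` cuboid n S), J, \<lambda>j. W j \<inter> c ` cuboid n S) \<in> C"
  shows "(sub (Rn n) (c ` cuboid n A), J, \<lambda>j. W j \<inter> c ` cuboid n A) \<in> C"
proof -
  have "(sub (Rn n) (c ` cuboid n B), J, \<lambda>j. W j \<inter> c ` cuboid n B) \<in> C"
    if "m \<le> n" "\<And>j. j < m \<Longrightarrow> B j \<in> P j" "\<And>j. m \<le> j \<Longrightarrow> j < n \<Longrightarrow> B j = A j" for m B
    using that
  proof (induction m arbitrary: B rule: inc_induct)
    case base
    then show ?case using cells by blast
  next
    case (step m)
    have "\<exists>h' g'. line_diffeo (B j) h' g' \<and> (j = m \<longrightarrow> h' = h m)" if "j < n" for j
      using line P_line[OF that] step.prems step.hyps that
      by (cases "j < m") (metis nat_neq_iff, metis not_less)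
    then obtain h' g' where h': "\<forall>j<n. line_diffeo (B j) (h' j) (g' j)" "h' m = h m"
      using step.hyps by metis
    show ?case
    proof (rule C_cut_cuboid[OF W _ h'(1)])
      show "m < n" using step.hyps by simp
      fix i
      show "(sub (Rn n) (c ` cuboid n (B(m := h' m ` {2 * real_of_int i<..<2 * real_of_int i + 3}))), J,
        \<lambda>j. W j \<inter> c ` cuboid n (B(m := h' m ` {2 * real_of_int i<..<2 * real_of_int i + 3}))) \<in> C"
        using step.prems step.hyps pieces[of m i] h'(2)
        by (intro step.IH) (auto simp: less_Suc_eq)
    qed
  qed
  from this[of 0 A] show ?thesis by simp
qed

text \<open>
  A Lebesgue number \<open>e\<close> of \<open>W\<close> on the closed box \<open>K\<close> exists by compactness. Cells with edges shorter
  than \<open>e / 4\<close> lie within \<open>2 (e / 4) < e\<close> of their lower corner, hence in one member of \<open>W\<close>.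
\<close>
lemma bounded_cuboid_in_C:
  assumes W: "open_cover (tp (Rn n)) J W" and ab: "\<And>j. j < n \<Longrightarrow> a j < b j"
  shows "(sub (Rn n) (c ` cuboid n (\<lambda>j. {a j<..<b j})), J,
           \<lambda>j. W j \<inter> c ` cuboid n (\<lambda>j. {a j<..<b j})) \<in> C"
proof -
  have "\<exists>T. open T \<and> W j = c ` (T \<inter> topspace (Euclidean_space n))" if "j \<in> J" for j
    using W that inj_c unfolding open_cover_def
    by (auto simp: tp_Rn openin_Rn_top Euclidean_space_def openin_subtopology euclidean_product_topology)
  then obtain T where T: "\<And>j. j \<in> J \<Longrightarrow> open (T j) \<and> W j = c ` (T j \<inter> topspace (Euclidean_space n))"
    by metis
  define K :: "(nat \<Rightarrow> real) set" where
    "K = {x. \<forall>j. x j \<in> {(if j < n then a j else 0)..(if j < n then b j else 0)}}"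
  have KR: "K \<subseteq> topspace (Euclidean_space n)"
  proof (unfold topspace_Euclidean_space, intro subsetI CollectI allI impI)
    fix x i assume "x \<in> K" "n \<le> i"
    then have "x i \<in> {(if i < n then a i else 0)..(if i < n then b i else 0)}" by (simp only: K_def mem_Collect_eq)
    then show "x i = 0" using \<open>n \<le> i\<close> by simp
  qed
  have "c ` topspace (Euclidean_space n) = (\<Union>j\<in>J. W j)"
    using W by (simp add: open_cover_def tp_Rn topspace_Rn_top[OF inj_c])
  then have "K \<subseteq> \<Union>(T ` J)"
    using KR T inj_c by (fastforce simp: inj_image_mem_iff image_iff dest: injD)
  moreover have "compact K" unfolding K_def by (rule compact_closed_cuboid)
  ultimately obtain e where e: "e > 0" "\<And>x. x \<in> K \<Longrightarrow> \<exists>G\<in>T ` J. ball x e \<subseteq> G"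
    using Heine_Borel_lemma[of K "T ` J"] T by blast
  then have e4: "e / 4 > 0" by simp
  define P where "P j = {{p<..<q} | p q. a j \<le> p \<and> p < q \<and> q \<le> b j \<and> q - p < e / 4}" for j
  have "\<exists>h g. line_diffeo {a j<..<b j} h g \<and>
      (\<forall>i::int. h ` {2 * real_of_int i<..<2 * real_of_int i + 3} \<in> P j)" if j: "j < n" for j
  proof -
    obtain h g where "line_diffeo {a j<..<b j} h g"
      "\<And>i::int. \<exists>p q. a j \<le> p \<and> p < q \<and> q \<le> b j \<and> q - p < e / 4 \<and>
         h ` {2 * real_of_int i<..<2 * real_of_int i + 3} = {p<..<q}"
      using fine_interval_parametrization[of "a j" "b j" "e / 4"] ab[OF j] e4 by metis
    then show ?thesis unfolding P_def by blast
  qed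
  then have "\<forall>j. \<exists>h g. j < n \<longrightarrow> line_diffeo {a j<..<b j} h g \<and>
      (\<forall>i::int. h ` {2 * real_of_int i<..<2 * real_of_int i + 3} \<in> P j)" by blast
  from choice[OF this] obtain h where "\<forall>j. \<exists>g. j < n \<longrightarrow> line_diffeo {a j<..<b j} (h j) g \<and>
      (\<forall>i::int. h j ` {2 * real_of_int i<..<2 * real_of_int i + 3} \<in> P j)" ..
  from choice[OF this] obtain g where hg: "\<forall>j<n. line_diffeo {a j<..<b j} (h j) (g j)"
    "\<And>j i. j < n \<Longrightarrow> h j ` {2 * real_of_int i<..<2 * real_of_int i + 3} \<in> P j" by blast
  have P_line: "\<exists>h g. line_diffeo S h g" if "S \<in> P j" for S j
    using that line_diffeo_logistic[of _ _ 1] by (auto simp: P_def)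
  show ?thesis
  proof (rule C_cut_grid[where P = P, OF W hg(1)])
    show "h j ` {2 * real_of_int i<..<2 * real_of_int i + 3} \<in> P j" if "j < n" for j i
      by (rule hg(2)[OF that])
    show "\<exists>h g. line_diffeo S h g" if "S \<in> P j" for S j by (rule P_line[OF that])
    fix S assume S: "\<And>j. j < n \<Longrightarrow> S j \<in> P j"
    then obtain p q where pq: "\<And>j. j < n \<Longrightarrow> S j = {p j<..<q j} \<and> a j \<le> p j \<and> p j < q j \<and> q j \<le> b j \<and> q j - p j < e / 4"
      unfolding P_def by (simp only: mem_Collect_eq) metis
    have SR: "cuboid n S \<subseteq> topspace (Euclidean_space n)" by (auto simp: cuboid_def)
    define x where "x j = (if j < n then p j else 0)" for j
    have "x \<in> K" using pq ab unfolding x_def K_def by (force intro: less_imp_le)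
    then obtain j where j: "j \<in> J" "ball x e \<subseteq> T j" using e(2) by blast
    have "cuboid n S \<subseteq> ball x e"
    proof
      fix y assume y: "y \<in> cuboid n S"
      have "dist (x i) (y i) \<le> e / 4" for i
      proof (cases "i < n")
        case True
        then have "y i \<in> {p i<..<q i}" using y pq by (auto simp: cuboid_def)
        then show ?thesis using pq[OF True] True by (auto simp: x_def dist_real_def)
      next
        case False
        then show ?thesis using y e(1) by (simp add: cuboid_def x_def topspace_Euclidean_space)
      qed
      then have "dist x y \<le> 2 * (e / 4)" by (rule dist_fun_le_of_coordinates)
      then show "y \<in> ball x e" using e(1) by simp
    qed
    then have sub: "c ` cuboid n S \<subseteq> W j" using T[OF j(1)] j(2) SR by blast
    have SX: "c ` cuboid n S \<subseteq> topspace (tp (Rn n))"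
      using SR by (auto simp: tp_Rn topspace_Rn_top[OF inj_c])
    show "(sub (Rn n) (c ` cuboid n S), J, \<lambda>j. W j \<inter> c ` cuboid n S) \<in> C"
    proof (rule C_if_whole_space_member[OF _ open_cover_restrict[OF W SX] j(1)])
      show "sub (Rn n) (c ` cuboid n S) \<in> M" using S P_line by (intro cuboid_in_M) blast
      show "topspace (tp (sub (Rn n) (c ` cuboid n S))) \<subseteq> W j \<inter> c ` cuboid n S"
        using sub by (auto simp: tp_sub)
    qed
  qed
qed

text \<open>The identity parametrization of the edges cuts \<open>R^n\<close> into bounded boxes.\<close>
lemma Rn_covers_in_C:
  assumes W: "open_cover (tp (Rn n)) J W"
  shows "(Rn n, J, W) \<in> C"
proof -
  define P where "P = {{p<..<q} | p q :: real. p < q}"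
  have "(sub (Rn n) (c ` cuboid n (\<lambda>_. UNIV)), J, \<lambda>j. W j \<inter> c ` cuboid n (\<lambda>_. UNIV)) \<in> C"
  proof (rule C_cut_grid[where P = "\<lambda>_. P", OF W])
    show "\<forall>j<n. line_diffeo UNIV (\<lambda>t. t) (\<lambda>t. t)" using line_diffeo_id by blast
    show "(\<lambda>t. t) ` {2 * real_of_int i<..<2 * real_of_int i + 3} \<in> P" for i
      by (force simp: P_def)
    show "\<exists>h g. line_diffeo S h g" if "S \<in> P" for S
      using that line_diffeo_logistic[of _ _ 1] by (auto simp: P_def)
    fix S assume "\<And>j. j < n \<Longrightarrow> S j \<in> P"
    then obtain p q where pq: "\<And>j. j < n \<Longrightarrow> S j = {p j<..<q j} \<and> p j < q j"
      unfolding P_def by (simp only: mem_Collect_eq) metis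
    then have "cuboid n S = cuboid n (\<lambda>j. {p j<..<q j})" by (auto simp: cuboid_def)
    then show "(sub (Rn n) (c ` cuboid n S), J, \<lambda>j. W j \<inter> c ` cuboid n S) \<in> C"
      using bounded_cuboid_in_C[OF W, of p q] pq by simp
  qed
  then have "(Rn n, J, \<lambda>j. W j \<inter> c ` cuboid n (\<lambda>_. UNIV)) \<in> C"
    unfolding cuboid_UNIV sub_Rn_whole .
  then show ?thesis
  proof (rule C_coarsen[OF _ W])
    show "refines J (\<lambda>j. W j \<inter> c ` cuboid n (\<lambda>_. UNIV)) J W"
      unfolding refines_def by (intro ballI bexI) simp_all
  qed
qed

lemma all_covers_subset_C: "all_covers tp M \<subseteq> C"
proof
  fix x assume "x \<in> all_covers tp M"
  then obtain X J W where x: "x = (X, J, W)" and X: "X \<in> M" and W: "open_cover (tp X) J W"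
    by (auto simp: all_covers_def)
  obtain I U d g where U: "open_cover (tp X) I U" "disjoint_family_on U (I :: 'u set)"
    and g: "\<And>i. i \<in> I \<Longrightarrow> isom (Rn (d i)) (sub X (U i)) (g i)"
    using X unfolding M_iff by blast
  have "(X, I, U) \<in> C" using C X U unfolding admissible_def contains_disjoint_def by blast
  then have "(X, J, W) \<in> C"
  proof (rule C_local[OF _ W])
    fix i assume i: "i \<in> I"
    have op: "openin (tp X) (U i)" using U i by (simp add: open_cover_def)
    have tU: "topspace (tp (sub X (U i))) = U i"
      using openin_subset[OF op] by (auto simp: tp_sub)
    have MU: "sub X (U i) \<in> M"
    proof (subst M_iff, intro conjI exI ballI)
      show "wellformed (sub X (U i))" using wellformed_sub[OF M_wellformed[OF X] op] .
      show "open_cover (tp (sub X (U i))) {i} (\<lambda>_. U i)"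
        using tU openin_topspace[of "tp (sub X (U i))"] by (simp add: open_cover_def)
      show "disjoint_family_on (\<lambda>_. U i) {i}" by (simp add: disjoint_family_on_def)
      show "isom (Rn (d i)) (sub (sub X (U i)) (U i)) (g i)" for i' using g[OF i] by (simp add: sub_sub)
    qed
    have homeo: "homeomorphic_map (tp (Rn (d i))) (tp (sub X (U i))) (g i)"
      by (rule isom_imp_homeomorphic_map[OF g[OF i]])
    define V where "V j = {x \<in> topspace (tp (Rn (d i))). g i x \<in> W j \<inter> U i}" for j
    have res: "open_cover (tp (sub X (U i))) J (\<lambda>j. W j \<inter> U i)"
      using openin_subset[OF op] by (rule open_cover_restrict[OF W])
    have V: "open_cover (tp (Rn (d i))) J V"
      unfolding open_cover_def
    proof (intro conjI ballI)
      show "openin (tp (Rn (d i))) (V j)" if "j \<in> J" for j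
        unfolding V_def
        using res that homeomorphic_imp_continuous_map[OF homeo]
        by (intro openin_continuous_map_preimage) (auto simp: open_cover_def)
      show "(\<Union>j\<in>J. V j) = topspace (tp (Rn (d i)))"
        using res homeomorphic_imp_surjective_map[OF homeo] unfolding open_cover_def V_def by blast
    qed
    have gV: "g i ` V j = W j \<inter> U i" for j
    proof -
      have "g i ` topspace (tp (Rn (d i))) = U i"
        using homeomorphic_imp_surjective_map[OF homeo] tU by simp
      then have "\<exists>x\<in>topspace (tp (Rn (d i))). y = g i x" if "y \<in> U i" for y using that by blast
      then show ?thesis unfolding V_def by auto
    qed
    have "(sub X (U i), J, \<lambda>j. g i ` V j) \<in> C"
      by (rule C_image_isom[OF Rn_covers_in_C[OF V] g[OF i] MU])
    then show "(sub X (U i), J, \<lambda>j. W j \<inter> U i) \<in> C" by (simp add: gV)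
  qed
  then show "x \<in> C" by (simp add: x)
qed

end

theorem all_covers_is_smallest:
  "is_smallest (admissible tp sub isom Rn c M) (all_covers tp M)"
  using admissible_all_covers all_covers_subset_C by (simp add: is_smallest_def)

end



section \<open>Disjoint unions as disjoint open covers\<close>
lemma openin_sum_slice:
  assumes i: "i \<in> I" and V: "openin (X i) V"
  shows "openin (sum_topology X I) ({i} \<times> V)"
proof -
  have "openin (sum_topology X I) (Pair i ` V)"
    using open_map_component_injection[OF i, of X] V unfolding open_map_def by blast
  moreover have "Pair i ` V = {i} \<times> V" by auto
  ultimately show ?thesis by simp
qed

definition summand_piece :: "('b \<Rightarrow> nat) \<Rightarrow> ('b \<times> (nat \<Rightarrow> real) \<Rightarrow> 'a) \<Rightarrow> 'b \<Rightarrow> 'a set" where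
  "summand_piece d f' i = (\<lambda>y. f' (i, y)) ` topspace (Euclidean_space (d i))"

text \<open>
  From external to internal disjoint unions. The maps are given explicitly because the smooth version
  of the statement is about the same maps.
\<close>
lemma pieces_of_disjoint_union:
  assumes c: "inj c"
    and f: "homeomorphic_maps X (sum_topology (\<lambda>i. Euclidean_space (d i)) I) f f'"
  shows "open_cover X I (summand_piece d f')"
    and "disjoint_family_on (summand_piece d f') I"
    and "\<And>i. i \<in> I \<Longrightarrow> homeomorphic_maps (Rn_top c (d i)) (subtopology X (summand_piece d f' i))
           (\<lambda>u. f' (i, inv c u)) (\<lambda>x. c (snd (f x)))"
    and "\<And>i x. i \<in> I \<Longrightarrow> x \<in> summand_piece d f' i \<Longrightarrow>
           fst (f x) = i \<and> snd (f x) \<in> topspace (Euclidean_space (d i))"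
proof -
  let ?E = "\<lambda>i. Euclidean_space (d i)"
  let ?S = "sum_topology ?E I"
  let ?U = "summand_piece d f'"
  have ff': "f (f' p) = p" if "p \<in> topspace ?S" for p
    using f that unfolding homeomorphic_maps_def by blast
  have f'f: "f' (f x) = x" if "x \<in> topspace X" for x
    using f that unfolding homeomorphic_maps_def by blast
  have cf: "continuous_map X ?S f" and cf': "continuous_map ?S X f'"
    using f by (simp_all add: homeomorphic_maps_def)
  have f'map: "homeomorphic_map ?S X f'"
    using f homeomorphic_maps_map homeomorphic_maps_sym by blast
  have fS: "f x \<in> Sigma I (\<lambda>i. topspace (?E i))" if "x \<in> topspace X" for x
    using continuous_map_image_subset_topspace[OF cf] that by (auto simp: o_def)
  have U_image: "?U i = f' ` ({i} \<times> topspace (?E i))" for i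
    by (auto simp: summand_piece_def)
  have slice: "openin ?S ({i} \<times> topspace (?E i))" if "i \<in> I" for i
    by (rule openin_sum_slice[OF that]) simp
  have Uop: "openin X (?U i)" if "i \<in> I" for i
    unfolding U_image using homeomorphic_imp_open_map[OF f'map] slice[OF that] by (simp add: open_map_def)
  show Upt: "fst (f x) = i \<and> snd (f x) \<in> topspace (?E i)" if "i \<in> I" "x \<in> ?U i" for i x
  proof -
    obtain y where "y \<in> topspace (?E i)" "x = f' (i, y)" using \<open>x \<in> ?U i\<close> by (auto simp: summand_piece_def)
    then show ?thesis using ff'[of "(i, y)"] \<open>i \<in> I\<close> by simp
  qed
  show "open_cover X I ?U"
    unfolding open_cover_def
  proof (intro conjI ballI Uop equalityI subsetI)
    fix x assume x: "x \<in> topspace X"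
    then have "x = f' (fst (f x), snd (f x))" using f'f by simp
    moreover have "fst (f x) \<in> I" "snd (f x) \<in> topspace (?E (fst (f x)))"
      using fS[OF x] by (auto simp: mem_Sigma_iff split: prod.splits)
    ultimately have "x \<in> ?U (fst (f x))" unfolding summand_piece_def by blast
    then show "x \<in> (\<Union>i\<in>I. ?U i)" using \<open>fst (f x) \<in> I\<close> by blast
  next
    fix x assume "x \<in> (\<Union>i\<in>I. ?U i)"
    then obtain i where "i \<in> I" "x \<in> ?U i" by (rule UN_E)
    then show "x \<in> topspace X" using openin_subset[OF Uop] by auto
  qed
  show "disjoint_family_on ?U I"
    unfolding disjoint_family_on_def
  proof (intro ballI impI)
    fix i j assume "i \<in> I" "j \<in> I" "i \<noteq> j"
    then show "?U i \<inter> ?U j = {}" using Upt by blast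
  qed
  fix i assume i: "i \<in> I"
  have 1: "continuous_map (Rn_top c (d i)) X (\<lambda>u. f' (i, inv c u))"
  proof -
    have "continuous_map (Rn_top c (d i)) (?E i) (inv c)"
      using homeomorphic_maps_Rn_top[OF c] by (simp add: homeomorphic_maps_def)
    from continuous_map_compose[OF continuous_map_compose[OF this continuous_map_component_injection[OF i, of ?E]] cf']
    show ?thesis by (simp add: o_def)
  qed
  have 2: "continuous_map (subtopology X (?U i)) (Rn_top c (d i)) (\<lambda>x. c (snd (f x)))"
  proof -
    have "continuous_map (subtopology X (?U i)) (?E i) (\<lambda>x. snd (f x))"
      unfolding continuous_map_def
    proof (intro conjI allI impI)
      show "(\<lambda>x. snd (f x)) \<in> topspace (subtopology X (?U i)) \<rightarrow> topspace (?E i)"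
        using Upt[OF i] by auto
      fix V assume V: "openin (?E i) V"
      have "{x \<in> topspace (subtopology X (?U i)). snd (f x) \<in> V} = {x \<in> topspace X. f x \<in> {i} \<times> V} \<inter> ?U i"
        using Upt[OF i] openin_subset[OF V] fS by (auto simp: prod_eq_iff mem_Times_iff) 
      moreover have "openin ?S ({i} \<times> V)" by (rule openin_sum_slice[where X = ?E, OF i V])
      then have "openin X {x \<in> topspace X. f x \<in> {i} \<times> V}"
        by (rule openin_continuous_map_preimage[OF cf])
      ultimately show "openin (subtopology X (?U i)) {x \<in> topspace (subtopology X (?U i)). snd (f x) \<in> V}"
        by (simp add: openin_subtopology_Int)
    qed
    moreover have "continuous_map (?E i) (Rn_top c (d i)) c"
      using homeomorphic_maps_Rn_top[OF c] by (simp add: homeomorphic_maps_def)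
    ultimately have "continuous_map (subtopology X (?U i)) (Rn_top c (d i)) (c \<circ> (\<lambda>x. snd (f x)))"
      by (rule continuous_map_compose)
    then show ?thesis by (simp add: o_def)
  qed
  show "homeomorphic_maps (Rn_top c (d i)) (subtopology X (?U i))
           (\<lambda>u. f' (i, inv c u)) (\<lambda>x. c (snd (f x)))"
    unfolding homeomorphic_maps_def
  proof (intro conjI ballI 2)
    show "continuous_map (Rn_top c (d i)) (subtopology X (?U i)) (\<lambda>u. f' (i, inv c u))"
      using 1 c by (auto simp: continuous_map_in_subtopology topspace_Rn_top summand_piece_def)
    show "c (snd (f (f' (i, inv c u)))) = u" if u: "u \<in> topspace (Rn_top c (d i))" for u
    proof -
      obtain y where y: "u = c y" "y \<in> topspace (?E i)" using u by (auto simp: topspace_Rn_top[OF c])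
      then show ?thesis using ff'[of "(i, y)"] i c by simp
    qed
    show "f' (i, inv c (c (snd (f x)))) = x" if "x \<in> topspace (subtopology X (?U i))" for x
    proof -
      have "x \<in> topspace X" "x \<in> ?U i" using that by auto
      then show ?thesis using f'f[of x] Upt[OF i, of x] c by (metis inv_f_f prod.collapse)
    qed
  qed
qed

definition piece_index :: "'b set \<Rightarrow> ('b \<Rightarrow> 'a set) \<Rightarrow> 'a \<Rightarrow> 'b" where
  "piece_index I U x = (THE i. i \<in> I \<and> x \<in> U i)"

lemma piece_index_eq:
  "disjoint_family_on U I \<Longrightarrow> i \<in> I \<Longrightarrow> x \<in> U i \<Longrightarrow> piece_index I U x = i"
  unfolding piece_index_def
proof (rule the_equality)
  fix j assume "disjoint_family_on U I" "i \<in> I" "x \<in> U i" "j \<in> I \<and> x \<in> U j"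
  then show "j = i" unfolding disjoint_family_on_def by blast
qed simp

lemma continuous_map_from_sum_topology:
  assumes "\<And>i. i \<in> I \<Longrightarrow> continuous_map (X i) Y (\<lambda>x. f (i, x))"
  shows "continuous_map (sum_topology X I) Y f"
  unfolding continuous_map_def
proof (intro conjI allI impI)
  show "f \<in> topspace (sum_topology X I) \<rightarrow> topspace Y"
    using assms continuous_map_image_subset_topspace by fastforce
  fix V assume "openin Y V"
  then have "openin (X i) {x \<in> topspace (X i). f (i, x) \<in> V}" if "i \<in> I" for i
    using assms[OF that] openin_continuous_map_preimage by fastforce
  then show "openin (sum_topology X I) {p \<in> topspace (sum_topology X I). f p \<in> V}"
    by (auto simp: openin_sum_topology)
qed

text \<open>
  Conversely, disjoint open pieces may be glued: on the piece \<open>U i\<close> the map to the disjoint union is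
  \<open>g' i\<close> followed by the inclusion of the \<open>i\<close>-th summand.
\<close>
lemma disjoint_union_of_pieces:
  assumes c: "inj c" and cov: "open_cover X I U" and disj: "disjoint_family_on U I"
    and g: "\<And>i. i \<in> I \<Longrightarrow> homeomorphic_maps (Rn_top c (d i)) (subtopology X (U i)) (g i) (g' i)"
  shows "homeomorphic_maps X (sum_topology (\<lambda>i. Euclidean_space (d i)) I)
           (\<lambda>x. (piece_index I U x, inv c (g' (piece_index I U x) x))) (\<lambda>(i, y). g i (c y))"
proof -
  let ?E = "\<lambda>i. Euclidean_space (d i)"
  let ?S = "sum_topology ?E I"
  have Uop: "openin X (U i)" if "i \<in> I" for i using cov that by (simp add: open_cover_def)
  have Usub: "U i \<subseteq> topspace X" if "i \<in> I" for i by (rule openin_subset[OF Uop[OF that]])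
  have ex: "\<exists>i\<in>I. x \<in> U i" if "x \<in> topspace X" for x
    using cov that unfolding open_cover_def by (metis UN_E)
  have pi: "piece_index I U x = i" if "i \<in> I" "x \<in> U i" for i x
    by (rule piece_index_eq[OF disj that])
  have g_cont: "continuous_map (Rn_top c (d i)) (subtopology X (U i)) (g i)"
    and g'_cont: "continuous_map (subtopology X (U i)) (Rn_top c (d i)) (g' i)"
    and g'g: "\<And>u. u \<in> topspace (Rn_top c (d i)) \<Longrightarrow> g' i (g i u) = u"
    and gg': "\<And>x. x \<in> U i \<Longrightarrow> g i (g' i x) = x" if "i \<in> I" for i
    using g[OF that] Usub[OF that] by (simp_all add: homeomorphic_maps_def subset_iff)
  have c_cont: "continuous_map (?E i) (Rn_top c (d i)) c"
    and ci_cont: "continuous_map (Rn_top c (d i)) (?E i) (inv c)" for i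
    using homeomorphic_maps_Rn_top[OF c] by (simp_all add: homeomorphic_maps_def)
  have gU: "g i (c y) \<in> U i" if "i \<in> I" "y \<in> topspace (?E i)" for i y
    using continuous_map_image_subset_topspace[OF g_cont[OF that(1)]] that(2) by (auto simp: topspace_Rn_top[OF c])
  have g'R: "g' i x \<in> c ` topspace (?E i)" if "i \<in> I" "x \<in> U i" for i x
    using continuous_map_image_subset_topspace[OF g'_cont[OF that(1)]] that Usub[OF that(1)]
    by (auto simp: topspace_Rn_top[OF c])
  show ?thesis
    unfolding homeomorphic_maps_def
  proof (intro conjI ballI)
    show "continuous_map X ?S (\<lambda>x. (piece_index I U x, inv c (g' (piece_index I U x) x)))"
    proof (rule pasting_lemma[where I = I and T = U and f = "\<lambda>i x. (i, inv c (g' i x))"])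
      show "openin X (U i)" if "i \<in> I" for i by (rule Uop[OF that])
      show "continuous_map (subtopology X (U i)) ?S (\<lambda>x. (i, inv c (g' i x)))" if "i \<in> I" for i
        using continuous_map_compose[OF continuous_map_compose[OF g'_cont[OF that] ci_cont]
            continuous_map_component_injection[OF that, of ?E]] by (simp add: o_def)
      show "(i, inv c (g' i x)) = (j, inv c (g' j x))" if "i \<in> I" "j \<in> I" "x \<in> topspace X \<inter> U i \<inter> U j" for i j x
        using pi[of i x] pi[of j x] that by simp
      show "\<exists>j. j \<in> I \<and> x \<in> U j \<and> (piece_index I U x, inv c (g' (piece_index I U x) x)) = (j, inv c (g' j x))"
        if "x \<in> topspace X" for x
        using ex[OF that] pi by blast
    qed
    show "continuous_map ?S X (\<lambda>(i, y). g i (c y))"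
    proof (rule continuous_map_from_sum_topology)
      fix i assume i: "i \<in> I"
      have "continuous_map (Rn_top c (d i)) X (g i)"
        using g_cont[OF i] by (simp add: continuous_map_in_subtopology)
      from continuous_map_compose[OF c_cont this]
      show "continuous_map (?E i) X (\<lambda>x. case (i, x) of (i, y) \<Rightarrow> g i (c y))" by (simp add: o_def)
    qed
    fix x assume "x \<in> topspace X"
    then obtain i where i: "i \<in> I" "x \<in> U i" using ex by blast
    show "(case (piece_index I U x, inv c (g' (piece_index I U x) x)) of (i, y) \<Rightarrow> g i (c y)) = x"
      using g'R[OF i] gg'[OF i] by (simp add: pi[OF i] f_inv_into_f image_iff) (metis c inv_f_f)
  next
    fix p assume "p \<in> topspace ?S"
    then obtain i y where p: "p = (i, y)" "i \<in> I" "y \<in> topspace (?E i)" by auto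
    show "(piece_index I U (case p of (i, y) \<Rightarrow> g i (c y)),
         inv c (g' (piece_index I U (case p of (i, y) \<Rightarrow> g i (c y))) (case p of (i, y) \<Rightarrow> g i (c y)))) = p"
      using gU[OF p(2,3)] p g'g[OF p(2), of "c y"] c by (simp add: pi topspace_Rn_top)
  qed
qed

lemma homeomorphic_maps_Rn_top_cuboid:
  assumes c: "inj c" and "\<forall>j<n. line_diffeo (A j) (h j) (g j)" "\<forall>j<n. \<sigma> j < n \<and> \<sigma> (\<sigma> j) = j"
  shows "homeomorphic_maps (Rn_top c n) (subtopology (Rn_top c n) (c ` cuboid n A))
           (c \<circ> coordinate_map n h \<sigma> \<circ> inv c) (c \<circ> coordinate_map n (\<lambda>j. g (\<sigma> j)) \<sigma> \<circ> inv c)"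
proof -
  have R: "homeomorphic_maps (Euclidean_space n) (Rn_top c n) c (inv c)"
    by (rule homeomorphic_maps_Rn_top[OF c])
  have "cuboid n A \<subseteq> topspace (Euclidean_space n)" by (auto simp: cuboid_def)
  then have cuboid: "homeomorphic_maps (subtopology (Euclidean_space n) (cuboid n A))
      (subtopology (Rn_top c n) (c ` cuboid n A)) c (inv c)"
    by (intro homeomorphic_maps_subtopologies[OF R]) (auto simp: topspace_Rn_top[OF c])
  have R': "homeomorphic_maps (Rn_top c n) (Euclidean_space n) (inv c) c"
    using R homeomorphic_maps_sym by blast
  note coordinates = homeomorphic_maps_coordinate_map[OF assms(2,3)]
  show ?thesis
    using homeomorphic_maps_compose[OF conjI[OF homeomorphic_maps_compose[OF conjI[OF R' coordinates]] cuboid]]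
    by (simp only: comp_assoc)
qed

section \<open>The topological case\<close>
lemma manifold_class_top:
  assumes c: "inj (c :: (nat \<Rightarrow> real) \<Rightarrow> 'u)"
  shows "manifold_class (\<lambda>X. X) subtopology homeomorphic_map (Rn_top c) c (M_top :: 'u topology set) (\<lambda>_. True)"
proof
  show "inj c" by (rule c)
  show "homeomorphic_map (Rn_top c n) (subtopology (Rn_top c n) (c ` cuboid n A)) (c \<circ> coordinate_map n h \<sigma> \<circ> inv c)"
    if "\<forall>j<n. line_diffeo (A j) (h j) (g j)" "\<forall>j<n. \<sigma> j < n \<and> \<sigma> (\<sigma> j) = j" for n A h g \<sigma>
    using homeomorphic_maps_Rn_top_cuboid[OF c that] homeomorphic_maps_map by blast
  show "X \<in> M_top \<longleftrightarrow> True \<and> (\<exists>(I :: 'u set) U d g. open_cover X I U \<and> disjoint_family_on U I \<and>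
            (\<forall>i\<in>I. homeomorphic_map (Rn_top c (d i)) (subtopology X (U i)) (g i)))" for X :: "'u topology"
  proof
    assume "X \<in> M_top"
    then obtain I :: "'u set" and d f f' where f: "homeomorphic_maps X (sum_topology (\<lambda>i. Euclidean_space (d i)) I) f f'"
      unfolding M_top_def homeomorphic_space_def by blast
    note pieces = pieces_of_disjoint_union[OF c f]
    have "\<forall>i\<in>I. homeomorphic_map (Rn_top c (d i)) (subtopology X (summand_piece d f' i)) (\<lambda>u. f' (i, inv c u))"
      using pieces(3) homeomorphic_maps_map by blast
    then show "True \<and> (\<exists>(I :: 'u set) U d g. open_cover X I U \<and> disjoint_family_on U I \<and>
            (\<forall>i\<in>I. homeomorphic_map (Rn_top c (d i)) (subtopology X (U i)) (g i)))"
      using pieces(1,2) by (intro conjI TrueI exI) 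
  next
    assume "True \<and> (\<exists>(I :: 'u set) U d g. open_cover X I U \<and> disjoint_family_on U I \<and>
            (\<forall>i\<in>I. homeomorphic_map (Rn_top c (d i)) (subtopology X (U i)) (g i)))"
    then obtain I :: "'u set" and U d g where U: "open_cover X I U" "disjoint_family_on U I"
      and g: "\<And>i. i \<in> I \<Longrightarrow> homeomorphic_map (Rn_top c (d i)) (subtopology X (U i)) (g i)" by blast
    have "\<forall>i. \<exists>g'. i \<in> I \<longrightarrow> homeomorphic_maps (Rn_top c (d i)) (subtopology X (U i)) (g i) g'"
      using g homeomorphic_map_maps by blast
    from choice[OF this] obtain g' where
      "\<And>i. i \<in> I \<Longrightarrow> homeomorphic_maps (Rn_top c (d i)) (subtopology X (U i)) (g i) (g' i)" by blast
    from disjoint_union_of_pieces[where d = d and g = g and g' = g', OF c U this]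
    show "X \<in> M_top"
      unfolding M_top_def homeomorphic_space_def by blast
  qed
qed (simp_all add: subtopology_subtopology)



section \<open>Smooth maps on open subsets of Euclidean space\<close>
lemma Ck_on_subset: "Ck_on n k S f \<Longrightarrow> T \<subseteq> S \<Longrightarrow> Ck_on n k T f"
proof (induction k arbitrary: f)
  case 0
  then show ?case by (auto intro: continuous_map_from_subtopology_mono)
next
  case (Suc k)
  from Suc.prems(1) obtain f' where
    "continuous_map (subtopology (Euclidean_space n) S) euclideanreal f"
    and f': "\<forall>i<n. (\<forall>x\<in>S. ((\<lambda>t. f (x(i := t))) has_real_derivative f' i x) (at (x i))) \<and> Ck_on n k S (f' i)"
    by auto
  then have "continuous_map (subtopology (Euclidean_space n) T) euclideanreal f"
    using Suc.prems(2) by (auto intro: continuous_map_from_subtopology_mono)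
  moreover have "\<forall>i<n. (\<forall>x\<in>T. ((\<lambda>t. f (x(i := t))) has_real_derivative f' i x) (at (x i))) \<and> Ck_on n k T (f' i)"
    using f' Suc.IH Suc.prems(2) by blast
  ultimately show ?case by auto
qed

text \<open>
  Partial derivatives are taken along \<open>x(i := t)\<close>; near \<open>t = x i\<close> this line stays in an open
  set, which makes differentiability of functions given on \<open>S\<close> a local matter.
\<close>
lemma eventually_line_in_open:
  assumes S: "openin (Euclidean_space n) S" and x: "x \<in> S" and i: "i < n"
  shows "\<forall>\<^sub>F t in nhds (x i). x(i := t) \<in> S"
proof -
  obtain T where T: "openin (powertop_real UNIV) T" "S = T \<inter> {x. \<forall>i\<ge>n. x i = 0}"
    using S by (auto simp: Euclidean_space_def openin_subtopology)
  have "continuous_map euclideanreal (powertop_real UNIV) (\<lambda>t. x(i := t))"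
    by (simp add: continuous_map_componentwise_UNIV fun_upd_def)
  then have "openin euclideanreal {t \<in> topspace euclideanreal. x(i := t) \<in> T}"
    using T(1) by (rule openin_continuous_map_preimage)
  then have "open {t. x(i := t) \<in> T}" by simp
  moreover have "x i \<in> {t. x(i := t) \<in> T}" using x T(2) by simp
  moreover have "x(i := t) \<in> S" if "t \<in> {t. x(i := t) \<in> T}" for t
    using that x T(2) i by auto
  ultimately show ?thesis unfolding eventually_nhds by blast
qed

lemma Ck_on_cong:
  assumes S: "openin (Euclidean_space n) S" and eq: "\<And>x. x \<in> S \<Longrightarrow> f x = g x" and f: "Ck_on n k S f"
  shows "Ck_on n k S g"
proof -
  have cont: "continuous_map (subtopology (Euclidean_space n) S) euclideanreal g"
    if "continuous_map (subtopology (Euclidean_space n) S) euclideanreal f"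
    using that eq by (rule continuous_map_eq) simp
  show ?thesis
  proof (cases k)
    case 0
    then show ?thesis using f cont by simp
  next
    case (Suc l)
    then obtain f' where "continuous_map (subtopology (Euclidean_space n) S) euclideanreal f"
      and f': "\<forall>i<n. (\<forall>x\<in>S. ((\<lambda>t. f (x(i := t))) has_real_derivative f' i x) (at (x i))) \<and> Ck_on n l S (f' i)"
      using f by auto
    moreover have "((\<lambda>t. g (x(i := t))) has_real_derivative f' i x) (at (x i))" if "i < n" "x \<in> S" for i x
    proof -
      have "\<forall>\<^sub>F t in nhds (x i). f (x(i := t)) = g (x(i := t))"
        using eventually_line_in_open[OF S that(2,1)] by eventually_elim (rule eq)
      moreover have "((\<lambda>t. f (x(i := t))) has_real_derivative f' i x) (at (x i))" using f' that by blast
      ultimately show ?thesis by (simp add: DERIV_cong_ev)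
    qed
    ultimately show ?thesis
      unfolding Suc Ck_on.simps by (intro conjI cont exI[of _ f']) blast+
  qed
qed

lemma smooth_between_cong:
  assumes "openin (Euclidean_space n) S" "\<And>x j. x \<in> S \<Longrightarrow> j < m \<Longrightarrow> F x j = G x j" "smooth_between n m S F"
  shows "smooth_between n m S G"
  unfolding smooth_between_def
proof (intro allI impI)
  fix j k assume j: "j < m"
  show "Ck_on n k S (\<lambda>x. G x j)"
  proof (rule Ck_on_cong[OF assms(1)])
    show "Ck_on n k S (\<lambda>x. F x j)" using assms(3) j by (simp add: smooth_between_def)
    show "F x j = G x j" if "x \<in> S" for x by (rule assms(2)[OF that j])
  qed
qed

lemma smooth_between_subset:
  "smooth_between n m S F \<Longrightarrow> T \<subseteq> S \<Longrightarrow> smooth_between n m T F"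
  unfolding smooth_between_def using Ck_on_subset by blast

lemma Ck_on_zero: "Ck_on n k S (\<lambda>_. 0)"
  by (induction k) (auto intro!: exI[of _ "\<lambda>_ _. 0"])

text \<open>
  The partial derivatives of a function of one coordinate are functions of the same coordinate
  or zero, so all of them exist as soon as the one-variable derivatives do.
\<close>
lemma Ck_on_coordinate:
  assumes "smooth_line A f" "i < n" "\<And>x. x \<in> S \<Longrightarrow> x i \<in> A"
  shows "Ck_on n k S (\<lambda>x. f (x i))"
proof -
  obtain D where D: "D 0 = f" "\<And>k x. x \<in> A \<Longrightarrow> (D k has_real_derivative D (Suc k) x) (at x)"
    using assms(1) unfolding smooth_line_def by blast
  have cont: "continuous_map (subtopology (Euclidean_space n) S) euclideanreal (\<lambda>x. D m (x i))" for m
  proof (rule continuous_map_coordinate[where A = A])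
    show "continuous_on A (D m)"
      using D(2) by (intro DERIV_continuous_on) (auto intro: has_field_derivative_at_within)
  qed (rule assms(3))
  have "Ck_on n k S (\<lambda>x. D m (x i))" for m
  proof (induction k arbitrary: m)
    case 0
    show ?case using cont by simp
  next
    case (Suc k)
    let ?D' = "\<lambda>j x. if j = i then D (Suc m) (x i) else 0"
    have "((\<lambda>t. D m ((x(j := t)) i)) has_real_derivative ?D' j x) (at (x j))" if "x \<in> S" for j x
      using D(2)[of "x i" m] assms(3)[OF that] by (cases "j = i") auto
    moreover have "Ck_on n k S (?D' j)" for j
      using Suc.IH[of "Suc m"] Ck_on_zero by (cases "j = i") auto
    ultimately show ?case unfolding Ck_on.simps by (intro conjI cont exI[of _ ?D']) blast
  qed
  from this[of 0] show ?thesis by (simp add: D(1))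
qed

lemma smooth_between_coordinate_map:
  assumes "\<And>j. j < n \<Longrightarrow> smooth_line (B j) (h j)" "\<And>j. j < n \<Longrightarrow> \<sigma> j < n"
    "\<And>j x. j < n \<Longrightarrow> x \<in> S \<Longrightarrow> x (\<sigma> j) \<in> B j"
  shows "smooth_between n n S (coordinate_map n h \<sigma>)"
  unfolding smooth_between_def
proof (intro allI impI)
  fix j k assume j: "j < n"
  have "Ck_on n k S (\<lambda>x. h j (x (\<sigma> j)))"
    by (rule Ck_on_coordinate[where i = "\<sigma> j" and A = "B j"])
       (use assms j in simp_all)
  then show "Ck_on n k S (\<lambda>x. coordinate_map n h \<sigma> x j)" using j by (simp add: coordinate_map_def)
qed

section \<open>Charts and diffeomorphisms\<close>

text \<open>
  This part of the definition of a smooth manifold is enough for maps into and out of a space to be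
  compared through charts; unlike the full definition, it is immediate for disjoint unions.
\<close>
definition charted :: "'a mfd \<Rightarrow> bool" where
  "charted X \<longleftrightarrow> (\<forall>h\<in>atlas X. is_chart (mtop X) h)"

lemma chartedD: "charted X \<Longrightarrow> h \<in> atlas X \<Longrightarrow> is_chart (mtop X) h"
  by (simp add: charted_def)

lemma chart_domain_open: "is_chart X (n, D, \<phi>) \<Longrightarrow> openin X D"
  by (simp add: is_chart_def)

lemma chart_domain_subset: "is_chart X (n, D, \<phi>) \<Longrightarrow> D \<subseteq> topspace X"
  by (simp add: is_chart_def openin_subset)

lemma chart_inj_on:
  assumes "is_chart X (n, D, \<phi>)" shows "inj_on \<phi> D"
proof -
  have "homeomorphic_map (subtopology X D) (subtopology (Euclidean_space n) (\<phi> ` D)) \<phi>"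
    using assms by (simp add: is_chart_def)
  then have "inj_on \<phi> (topspace (subtopology X D))" by (rule homeomorphic_imp_injective_map)
  then show ?thesis using chart_domain_subset[OF assms] by (simp add: inf_absorb2)
qed

lemma chart_open_image:
  assumes ch: "is_chart X (n, D, \<phi>)" and T: "openin X T" "T \<subseteq> D"
  shows "openin (Euclidean_space n) (\<phi> ` T)"
proof -
  have h: "homeomorphic_map (subtopology X D) (subtopology (Euclidean_space n) (\<phi> ` D)) \<phi>"
    and o: "openin (Euclidean_space n) (\<phi> ` D)"
    using ch by (simp_all add: is_chart_def)
  have "openin (subtopology X D) T"
    using T chart_domain_open[OF ch] by (simp add: openin_open_subtopology)
  then have "openin (subtopology (Euclidean_space n) (\<phi> ` D)) (\<phi> ` T)"
    using homeomorphic_imp_open_map[OF h] by (simp add: open_map_def)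
  then show ?thesis by (rule openin_trans_full[OF _ o])
qed

lemma chart_open_preimage:
  assumes "is_chart X (n, D, \<phi>)" "continuous_map X Y f" "openin Y E"
  shows "openin (Euclidean_space n) (\<phi> ` (D \<inter> f -` E))"
proof (rule chart_open_image[OF assms(1)])
  have "D \<inter> f -` E = D \<inter> {x \<in> topspace X. f x \<in> E}"
    using chart_domain_subset[OF assms(1)] by auto
  then show "openin X (D \<inter> f -` E)"
    using chart_domain_open[OF assms(1)] openin_continuous_map_preimage[OF assms(2,3)]
    by (simp add: openin_Int)
qed simp

lemma chart_restrict:
  assumes ch: "is_chart X (n, D, \<phi>)" and W: "openin X W"
  shows "is_chart (subtopology X W) (n, D \<inter> W, \<phi>)"
proof -
  have DX: "D \<subseteq> topspace X" by (rule chart_domain_subset[OF ch])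
  have h: "homeomorphic_map (subtopology X D) (subtopology (Euclidean_space n) (\<phi> ` D)) \<phi>"
    and oE: "openin (Euclidean_space n) (\<phi> ` D)"
    using ch by (simp_all add: is_chart_def)
  have o: "openin X (D \<inter> W)" using chart_domain_open[OF ch] W by (rule openin_Int)
  have "homeomorphic_map (subtopology (subtopology X D) (D \<inter> W))
      (subtopology (subtopology (Euclidean_space n) (\<phi> ` D)) (\<phi> ` (D \<inter> W))) \<phi>"
    using h
  proof (rule homeomorphic_map_subtopologies)
    show "\<phi> ` (topspace (subtopology X D) \<inter> (D \<inter> W)) =
        topspace (subtopology (Euclidean_space n) (\<phi> ` D)) \<inter> \<phi> ` (D \<inter> W)"
      using DX openin_subset[OF oE] by auto
  qed
  moreover have "subtopology (subtopology X D) (D \<inter> W) = subtopology (subtopology X W) (D \<inter> W)"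
    unfolding subtopology_subtopology by (rule arg_cong[of _ _ "subtopology X"]) auto
  moreover have "subtopology (subtopology (Euclidean_space n) (\<phi> ` D)) (\<phi> ` (D \<inter> W)) =
      subtopology (Euclidean_space n) (\<phi> ` (D \<inter> W))"
    unfolding subtopology_subtopology by (rule arg_cong[of _ _ "subtopology (Euclidean_space n)"]) auto
  ultimately show ?thesis
    using chart_open_image[OF ch o] o W by (simp add: is_chart_def openin_open_subtopology)
qed

text \<open>
  The replacement for the chain rule. If \<open>\<tau>\<close> identifies the domain of one chart expression with part
  of the domain of another, compatibly with charts and maps, then both expressions are the
  same function on open subsets of Euclidean space, up to restriction.
\<close>
lemma smooth_between_transport:
  assumes sm: "smooth_between n m (\<phi> ` (D \<inter> f -` E)) (\<psi> \<circ> f \<circ> inv_into D \<phi>)"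
    and inj: "inj_on \<phi> D" and inj': "inj_on \<phi>' D'"
    and op: "openin (Euclidean_space n) (\<phi>' ` (D' \<inter> f' -` E'))"
    and \<tau>: "\<And>x. x \<in> D' \<Longrightarrow> f' x \<in> E' \<Longrightarrow>
      \<tau> x \<in> D \<and> f (\<tau> x) \<in> E \<and> \<phi> (\<tau> x) = \<phi>' x \<and> \<psi> (f (\<tau> x)) = \<psi>' (f' x)"
  shows "smooth_between n m (\<phi>' ` (D' \<inter> f' -` E')) (\<psi>' \<circ> f' \<circ> inv_into D' \<phi>')"
proof (rule smooth_between_cong[OF op])
  have "\<phi>' x \<in> \<phi> ` (D \<inter> f -` E)" if "x \<in> D' \<inter> f' -` E'" for x
    using \<tau>[of x] that by (intro image_eqI[of _ \<phi> "\<tau> x"]) auto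
  then show "smooth_between n m (\<phi>' ` (D' \<inter> f' -` E')) (\<psi> \<circ> f \<circ> inv_into D \<phi>)"
    by (intro smooth_between_subset[OF sm]) blast
  fix y j assume "y \<in> \<phi>' ` (D' \<inter> f' -` E')"
  then obtain x where x: "y = \<phi>' x" "x \<in> D'" "f' x \<in> E'" by auto
  note t = \<tau>[OF x(2,3)]
  have "inv_into D' \<phi>' y = x" using inj' x by simp
  moreover have "inv_into D \<phi> y = \<tau> x" using inj t x(1) by (metis inv_into_f_f)
  ultimately show "(\<psi> \<circ> f \<circ> inv_into D \<phi>) y j = (\<psi>' \<circ> f' \<circ> inv_into D' \<phi>') y j"
    using t by simp
qed

lemma smooth_mapD:
  "smooth_map X Y f \<Longrightarrow> (n, D, \<phi>) \<in> atlas X \<Longrightarrow> (m, E, \<psi>) \<in> atlas Y \<Longrightarrow>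
     smooth_between n m (\<phi> ` (D \<inter> f -` E)) (\<psi> \<circ> f \<circ> inv_into D \<phi>)"
  unfolding smooth_map_def by blast

lemma smooth_mapI:
  assumes X: "charted X" and Y: "charted Y" and cont: "continuous_map (mtop X) (mtop Y) f"
    and loc: "\<And>n D \<phi> m E \<psi>. \<lbrakk>(n, D, \<phi>) \<in> atlas X; (m, E, \<psi>) \<in> atlas Y; inj_on \<phi> D; D \<subseteq> topspace (mtop X);
        openin (Euclidean_space n) (\<phi> ` (D \<inter> f -` E))\<rbrakk> \<Longrightarrow>
      smooth_between n m (\<phi> ` (D \<inter> f -` E)) (\<psi> \<circ> f \<circ> inv_into D \<phi>)"
  shows "smooth_map X Y f"
  unfolding smooth_map_def
proof (intro conjI cont ballI, clarify)
  fix n D \<phi> m E \<psi> assume a: "(n, D, \<phi>) \<in> atlas X" "(m, E, \<psi>) \<in> atlas Y"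
  note ch = chartedD[OF X a(1)]
  show "smooth_between n m (\<phi> ` (D \<inter> f -` E)) (\<psi> \<circ> f \<circ> inv_into D \<phi>)"
    by (rule loc[OF a chart_inj_on[OF ch] chart_domain_subset[OF ch]
          chart_open_preimage[OF ch cont chart_domain_open[OF chartedD[OF Y a(2)]]]])
qed

text \<open>
  Diffeomorphisms are defined with \<open>inv_into\<close>; for explicit maps it is more convenient to exhibit the inverse.
\<close>
lemma diffeoI:
  assumes f: "homeomorphic_maps (mtop X) (mtop Y) f f'" and X: "charted X" and Y: "charted Y"
    and "smooth_map X Y f" and f': "smooth_map Y X f'"
  shows "diffeo X Y f"
  unfolding diffeo_def
proof (intro conjI assms)
  have "homeomorphic_map (mtop X) (mtop Y) f" using f homeomorphic_maps_map by blast
  then show bij: "bij_betw f (topspace (mtop X)) (topspace (mtop Y))"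
    by (simp add: bij_betw_def homeomorphic_imp_injective_map homeomorphic_imp_surjective_map)
  have eq: "inv_into (topspace (mtop X)) f y = f' y" if "y \<in> topspace (mtop Y)" for y
  proof (rule inv_into_f_eq)
    show "inj_on f (topspace (mtop X))" using bij by (simp add: bij_betw_def)
    show "f' y \<in> topspace (mtop X)" "f (f' y) = y"
      using f that continuous_map_image_subset_topspace[of "mtop Y" "mtop X" f'] by (auto simp: homeomorphic_maps_def)
  qed
  show "smooth_map Y X (inv_into (topspace (mtop X)) f)"
  proof (rule smooth_mapI[OF Y X])
    show "continuous_map (mtop Y) (mtop X) (inv_into (topspace (mtop X)) f)"
    proof (rule continuous_map_eq)
      show "continuous_map (mtop Y) (mtop X) f'" using f unfolding homeomorphic_maps_def by blast
      show "f' y = inv_into (topspace (mtop X)) f y" if "y \<in> topspace (mtop Y)" for y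
        using eq[OF that] by simp
    qed
    fix n D \<phi> m E \<psi>
    assume a: "(n, D, \<phi>) \<in> atlas Y" "(m, E, \<psi>) \<in> atlas X" and inj: "inj_on \<phi> D"
      and D: "D \<subseteq> topspace (mtop Y)"
      and op: "openin (Euclidean_space n) (\<phi> ` (D \<inter> inv_into (topspace (mtop X)) f -` E))"
    show "smooth_between n m (\<phi> ` (D \<inter> inv_into (topspace (mtop X)) f -` E))
        (\<psi> \<circ> inv_into (topspace (mtop X)) f \<circ> inv_into D \<phi>)"
    proof (rule smooth_between_transport[where \<tau> = "\<lambda>x. x", OF smooth_mapD[OF f' a] inj inj op])
      fix y assume "y \<in> D" "inv_into (topspace (mtop X)) f y \<in> E"
      moreover have "inv_into (topspace (mtop X)) f y = f' y" using \<open>y \<in> D\<close> D by (intro eq) auto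
      ultimately show "y \<in> D \<and> f' y \<in> E \<and> \<phi> y = \<phi> y \<and> \<psi> (f' y) = \<psi> (inv_into (topspace (mtop X)) f y)"
        by simp
    qed
  qed
qed

lemma diffeo_homeomorphic_maps:
  assumes "diffeo X Y f"
  shows "homeomorphic_maps (mtop X) (mtop Y) f (inv_into (topspace (mtop X)) f)"
proof -
  have bij: "bij_betw f (topspace (mtop X)) (topspace (mtop Y))"
    and "continuous_map (mtop X) (mtop Y) f"
    and "continuous_map (mtop Y) (mtop X) (inv_into (topspace (mtop X)) f)"
    using assms unfolding diffeo_def smooth_map_def by blast+
  then show ?thesis
    using bij_betw_inv_into_left[OF bij] bij_betw_inv_into_right[OF bij]
    by (simp add: homeomorphic_maps_def)
qed

lemma charted_manifold: "smooth_manifold X \<Longrightarrow> charted X"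
  by (simp add: smooth_manifold_def charted_def)

lemma smooth_manifold_transition:
  assumes X: "smooth_manifold X" and "(n, D, \<phi>) \<in> atlas X" "(m, E, \<psi>) \<in> atlas X"
  shows "smooth_between n m (\<phi> ` (D \<inter> E)) (\<psi> \<circ> inv_into D \<phi>)"
proof -
  from X have "\<forall>(n, D, \<phi>)\<in>atlas X. \<forall>(m, E, \<psi>)\<in>atlas X.
      smooth_between n m (\<phi> ` (D \<inter> E)) (\<psi> \<circ> inv_into D \<phi>)"
    unfolding smooth_manifold_def by (elim conjE)
  from bspec[OF this assms(2)] have "\<forall>(m, E, \<psi>)\<in>atlas X.
      smooth_between n m (\<phi> ` (D \<inter> E)) (\<psi> \<circ> inv_into D \<phi>)"
    by (simp only: prod.case)
  from bspec[OF this assms(3)] show ?thesis by (simp only: prod.case)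
qed

lemma charted_open_submfd: "charted X \<Longrightarrow> openin (mtop X) W \<Longrightarrow> charted (open_submfd X W)"
  unfolding charted_def open_submfd_def by (auto intro: chart_restrict)

text \<open>
  The transition maps are restrictions of the old ones, but \<open>inv_into (D \<inter> W) \<phi>\<close> agrees with
  \<open>inv_into D \<phi>\<close> only on the image of \<open>D \<inter> W\<close>; this is an instance of transport along the identity.
\<close>
lemma smooth_manifold_open_submfd:
  assumes X: "smooth_manifold X" and W: "openin (mtop X) W"
  shows "smooth_manifold (open_submfd X W)"
  unfolding smooth_manifold_def
proof (intro conjI)
  have ch: "charted X" by (rule charted_manifold[OF X])
  show "Hausdorff_space (mtop (open_submfd X W))"
    using X by (simp add: smooth_manifold_def open_submfd_def Hausdorff_space_subtopology)
  show "\<forall>h\<in>atlas (open_submfd X W). is_chart (mtop (open_submfd X W)) h"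
    using charted_open_submfd[OF ch W] by (simp add: charted_def)
  have "(\<Union>(n, D, \<phi>)\<in>atlas (open_submfd X W). D) = (\<Union>(n, D, \<phi>)\<in>atlas X. D \<inter> W)"
    by (simp add: open_submfd_def case_prod_unfold)
  also have "\<dots> = (\<Union>(n, D, \<phi>)\<in>atlas X. D) \<inter> W"
    by (simp add: case_prod_unfold)
  also have "(\<Union>(n, D, \<phi>)\<in>atlas X. D) = topspace (mtop X)" using X by (simp add: smooth_manifold_def)
  finally show "(\<Union>(n, D, \<phi>)\<in>atlas (open_submfd X W). D) = topspace (mtop (open_submfd X W))"
    by (simp add: open_submfd_def)
  show "\<forall>(n, D, \<phi>)\<in>atlas (open_submfd X W). \<forall>(m, E, \<psi>)\<in>atlas (open_submfd X W).
        smooth_between n m (\<phi> ` (D \<inter> E)) (\<psi> \<circ> inv_into D \<phi>)"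
  proof (intro ballI, clarify)
    fix n D' \<phi> m E' \<psi> assume "(n, D', \<phi>) \<in> atlas (open_submfd X W)" "(m, E', \<psi>) \<in> atlas (open_submfd X W)"
    then obtain D E where D: "(n, D, \<phi>) \<in> atlas X" "D' = D \<inter> W" and E: "(m, E, \<psi>) \<in> atlas X" "E' = E \<inter> W"
      by (auto simp: open_submfd_def)
    have chD: "is_chart (mtop X) (n, D, \<phi>)" and chE: "is_chart (mtop X) (m, E, \<psi>)"
      by (rule chartedD[OF ch D(1)] chartedD[OF ch E(1)])+
    have sm: "smooth_between n m (\<phi> ` (D \<inter> E)) (\<psi> \<circ> inv_into D \<phi>)"
      by (rule smooth_manifold_transition[OF X D(1) E(1)])
    have "openin (mtop X) (D' \<inter> E')"
      unfolding D E using W chart_domain_open[OF chD] chart_domain_open[OF chE] by (intro openin_Int)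
    then have op: "openin (Euclidean_space n) (\<phi> ` (D' \<inter> E'))"
      by (rule chart_open_image[OF chD]) (auto simp: D)
    have inj': "inj_on \<phi> D'" by (rule inj_on_subset[OF chart_inj_on[OF chD]]) (simp add: D)
    have "smooth_between n m (\<phi> ` (D' \<inter> id -` E')) (\<psi> \<circ> id \<circ> inv_into D' \<phi>)"
    proof (rule smooth_between_transport[OF _ chart_inj_on[OF chD] inj'])
      show "smooth_between n m (\<phi> ` (D \<inter> id -` E)) (\<psi> \<circ> id \<circ> inv_into D \<phi>)" using sm by simp
      show "openin (Euclidean_space n) (\<phi> ` (D' \<inter> id -` E'))" using op by simp
      show "id x \<in> D \<and> id (id x) \<in> E \<and> \<phi> (id x) = \<phi> x \<and> \<psi> (id (id x)) = \<psi> (id x)"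
        if "x \<in> D'" "id x \<in> E'" for x using that by (simp add: D E)
    qed
    then show "smooth_between n m (\<phi> ` (D' \<inter> E')) (\<psi> \<circ> inv_into D' \<phi>)" by simp
  qed
qed

lemma charted_Rn_smooth:
  assumes c: "inj c" shows "charted (Rn_smooth c n)"
proof -
  have "homeomorphic_map (Rn_top c n) (Euclidean_space n) (inv c)"
    using homeomorphic_maps_Rn_top[OF c] homeomorphic_maps_map by blast
  moreover have "inv c ` c ` topspace (Euclidean_space n) = topspace (Euclidean_space n)"
    using c by (simp add: image_inv_f_f)
  moreover have "subtopology (Rn_top c n) (c ` topspace (Euclidean_space n)) = Rn_top c n"
    using subtopology_topspace[of "Rn_top c n"] by (simp add: topspace_Rn_top[OF c])
  moreover have "openin (Rn_top c n) (c ` topspace (Euclidean_space n))"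
    by (rule openin_Rn_top_image[OF c openin_topspace])
  ultimately show ?thesis
    by (simp add: charted_def Rn_smooth_def is_chart_def)
qed

lemma smooth_manifold_Rn_smooth:
  assumes c: "inj c" shows "smooth_manifold (Rn_smooth c n)"
proof -
  have "Euclidean_space n homeomorphic_space Rn_top c n"
    using homeomorphic_maps_Rn_top[OF c] homeomorphic_space_def by blast
  then have "Hausdorff_space (Rn_top c n)"
    using Hausdorff_Euclidean_space homeomorphic_Hausdorff_space by blast
  moreover have "smooth_between n n (topspace (Euclidean_space n)) (inv c \<circ> inv_into (c ` topspace (Euclidean_space n)) (inv c))"
  proof (rule smooth_between_cong[of _ _ _ "coordinate_map n (\<lambda>_ t. t) (\<lambda>j. j)"])
    show "smooth_between n n (topspace (Euclidean_space n)) (coordinate_map n (\<lambda>_ t. t) (\<lambda>j. j))"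
      using line_diffeo_id by (intro smooth_between_coordinate_map[where B = "\<lambda>_. UNIV"]) (auto simp: line_diffeo_def)
    fix x j assume "x \<in> topspace (Euclidean_space n)" "j < n"
    then show "coordinate_map n (\<lambda>_ t. t) (\<lambda>j. j) x j = (inv c \<circ> inv_into (c ` topspace (Euclidean_space n)) (inv c)) x j"
      using f_inv_into_f[of x "inv c" "c ` topspace (Euclidean_space n)"] c
      by (simp add: coordinate_map_def image_inv_f_f)
  qed simp
  ultimately show ?thesis
    using charted_Rn_smooth[OF c, of n] c
    by (simp add: smooth_manifold_def charted_def Rn_smooth_def topspace_Rn_top image_inv_f_f)
qed

section \<open>The smooth case\<close>
abbreviation Euclidean_sum :: "('b \<Rightarrow> nat) \<Rightarrow> 'b set \<Rightarrow> ('b \<times> (nat \<Rightarrow> real)) mfd" where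
  "Euclidean_sum d I \<equiv> disjoint_union_mfd (\<lambda>i. Euclidean_mfd (d i)) I"

lemma mtop_Euclidean_sum: "mtop (Euclidean_sum d I) = sum_topology (\<lambda>i. Euclidean_space (d i)) I"
  by (simp add: disjoint_union_mfd_def Euclidean_mfd_def)

lemma atlas_Euclidean_sum:
  "atlas (Euclidean_sum d I) = (\<lambda>i. (d i, {i} \<times> topspace (Euclidean_space (d i)), snd)) ` I"
  by (auto simp: disjoint_union_mfd_def Euclidean_mfd_def)

lemma charted_Euclidean_sum: "charted (Euclidean_sum d I)"
  unfolding charted_def mtop_Euclidean_sum atlas_Euclidean_sum
proof clarify
  fix i assume i: "i \<in> I"
  let ?E = "\<lambda>i. Euclidean_space (d i)"
  let ?S = "sum_topology ?E I"
  let ?D = "{i} \<times> topspace (?E i)"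
  have op: "openin ?S ?D" by (rule openin_sum_slice[where X = ?E, OF i]) simp
  have "homeomorphic_map (?E i) (subtopology ?S (Pair i ` topspace (?E i))) (Pair i)"
    using embedding_map_component_injection[OF i, of ?E] unfolding embedding_map_def .
  moreover have D: "Pair i ` topspace (?E i) = ?D" by auto
  ultimately obtain q where q: "homeomorphic_maps (?E i) (subtopology ?S ?D) (Pair i) q"
    unfolding D homeomorphic_map_maps by blast
  have "homeomorphic_map (subtopology ?S ?D) (?E i) q"
    using q homeomorphic_maps_map homeomorphic_maps_sym by blast
  moreover have "q p = snd p" if "p \<in> topspace (subtopology ?S ?D)" for p
    using that q by (auto simp: homeomorphic_maps_def)
  ultimately have "homeomorphic_map (subtopology ?S ?D) (?E i) snd"
    by (rule homeomorphic_map_eq)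
  moreover have "snd ` ?D = topspace (?E i)" by simp
  ultimately show "is_chart ?S (d i, ?D, snd)" using op by (simp add: is_chart_def)
qed



lemma atlas_Rn_smooth: "atlas (Rn_smooth c n) = {(n, c ` topspace (Euclidean_space n), inv c)}"
  by (simp add: Rn_smooth_def)

lemma mtop_Rn_smooth: "mtop (Rn_smooth c n) = Rn_top c n"
  by (simp add: Rn_smooth_def)

lemma mtop_open_submfd: "mtop (open_submfd X W) = subtopology (mtop X) W"
  by (simp add: open_submfd_def)

lemma in_atlas_open_submfd:
  "(n, D, \<phi>) \<in> atlas (open_submfd X W) \<longleftrightarrow> (\<exists>D'. (n, D', \<phi>) \<in> atlas X \<and> D = D' \<inter> W)"
  by (force simp: open_submfd_def image_iff)

lemma open_submfd_open_submfd:
  "open_submfd (open_submfd X W) W' = open_submfd X (W \<inter> W')"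
  unfolding open_submfd_def
  by (simp add: subtopology_subtopology image_image case_prod_unfold Int_assoc)

lemma open_submfd_topspace:
  assumes "charted X" shows "open_submfd X (topspace (mtop X)) = X"
proof -
  have "(\<lambda>(n, D, \<phi>). (n, D \<inter> topspace (mtop X), \<phi>)) h = h" if "h \<in> atlas X" for h
  proof -
    obtain n D \<phi> where h: "h = (n, D, \<phi>)" by (cases h)
    have "D \<subseteq> topspace (mtop X)"
      by (rule chart_domain_subset[OF chartedD[OF assms that[unfolded h]]])
    then show ?thesis by (simp add: h inf_absorb1)
  qed
  then have "(\<lambda>(n, D, \<phi>). (n, D \<inter> topspace (mtop X), \<phi>)) ` atlas X = atlas X"
    by (metis (no_types, lifting) image_cong image_ident)
  then show ?thesis by (simp add: open_submfd_def)
qed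
text \<open>
  There is one chart on either side, and in these charts the map and its inverse are coordinate maps.
\<close>
lemma diffeo_cuboid:
  assumes c: "inj c" and line: "\<forall>j<n. line_diffeo (A j) (h j) (g j)"
    and \<sigma>: "\<forall>j<n. \<sigma> j < n \<and> \<sigma> (\<sigma> j) = j"
  shows "diffeo (Rn_smooth c n) (open_submfd (Rn_smooth c n) (c ` cuboid n A))
           (c \<circ> coordinate_map n h \<sigma> \<circ> inv c)"
proof -
  let ?R = "c ` topspace (Euclidean_space n)" and ?B = "c ` cuboid n A"
  let ?X = "Rn_smooth c n" and ?F = "coordinate_map n h \<sigma>" and ?G = "coordinate_map n (\<lambda>j. g (\<sigma> j)) \<sigma>"
  let ?Y = "open_submfd ?X ?B"
  have "\<And>j. j < n \<Longrightarrow> open (A j)" using line by (simp add: line_diffeo_def)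
  then have op: "openin (Euclidean_space n) (cuboid n A)" by (rule openin_cuboid)
  have X: "charted ?X" by (rule charted_Rn_smooth[OF c])
  have Y: "charted ?Y"
    by (rule charted_open_submfd[OF X]) (simp add: mtop_Rn_smooth openin_Rn_top_image[OF c op])
  have homeo: "homeomorphic_maps (mtop ?X) (mtop ?Y) (c \<circ> ?F \<circ> inv c) (c \<circ> ?G \<circ> inv c)"
    unfolding mtop_open_submfd mtop_Rn_smooth by (rule homeomorphic_maps_Rn_top_cuboid[OF c line \<sigma>])
  have bR: "cuboid n A \<subseteq> topspace (Euclidean_space n)" by (rule openin_subset[OF op])
  \<comment> \<open>Shared by the map and its inverse: in the chart \<open>inv c\<close>, the map \<open>c \<circ> H \<circ> inv c\<close> is \<open>H\<close>.\<close>
  have local_expression: "smooth_between n n (inv c ` (D \<inter> (c \<circ> H \<circ> inv c) -` E)) (inv c \<circ> (c \<circ> H \<circ> inv c) \<circ> inv_into D (inv c))"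
    if inj: "inj_on (inv c) D" and o: "openin (Euclidean_space n) (inv c ` (D \<inter> (c \<circ> H \<circ> inv c) -` E))"
      and H: "smooth_between n n (inv c ` D) H" for D E H
  proof (rule smooth_between_cong[OF o])
    show "smooth_between n n (inv c ` (D \<inter> (c \<circ> H \<circ> inv c) -` E)) H"
      by (rule smooth_between_subset[OF H]) blast
    fix x j assume "x \<in> inv c ` (D \<inter> (c \<circ> H \<circ> inv c) -` E)"
    then have "x \<in> inv c ` D" by blast
    then have "inv c (inv_into D (inv c) x) = x" by (rule f_inv_into_f)
    then show "H x j = (inv c \<circ> (c \<circ> H \<circ> inv c) \<circ> inv_into D (inv c)) x j" using c by simp
  qed
  show ?thesis
  proof (rule diffeoI[OF homeo X Y])
    show "smooth_map ?X ?Y (c \<circ> ?F \<circ> inv c)"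
    proof (rule smooth_mapI[OF X Y])
      show "continuous_map (mtop ?X) (mtop ?Y) (c \<circ> ?F \<circ> inv c)"
        using homeo unfolding homeomorphic_maps_def by blast
      fix m D \<phi> m' E \<psi>
      assume a: "(m, D, \<phi>) \<in> atlas ?X" "(m', E, \<psi>) \<in> atlas ?Y" and inj: "inj_on \<phi> D"
        and o: "openin (Euclidean_space m) (\<phi> ` (D \<inter> (c \<circ> ?F \<circ> inv c) -` E))"
      have eqs: "m = n" "D = ?R" "\<phi> = inv c" "m' = n" "\<psi> = inv c"
        using a by (simp_all add: in_atlas_open_submfd atlas_Rn_smooth)
      have "smooth_between n n (inv c ` ?R) ?F"
        using line \<sigma> by (intro smooth_between_coordinate_map[where B = "\<lambda>_. UNIV"]) (simp_all add: line_diffeo_def)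
      with inj o show "smooth_between m m' (\<phi> ` (D \<inter> (c \<circ> ?F \<circ> inv c) -` E))
          (\<psi> \<circ> (c \<circ> ?F \<circ> inv c) \<circ> inv_into D \<phi>)"
        unfolding eqs by (rule local_expression)
    qed
    show "smooth_map ?Y ?X (c \<circ> ?G \<circ> inv c)"
    proof (rule smooth_mapI[OF Y X])
      show "continuous_map (mtop ?Y) (mtop ?X) (c \<circ> ?G \<circ> inv c)"
        using homeo unfolding homeomorphic_maps_def by blast
      fix m D \<phi> m' E \<psi>
      assume a: "(m, D, \<phi>) \<in> atlas ?Y" "(m', E, \<psi>) \<in> atlas ?X" and inj: "inj_on \<phi> D"
        and o: "openin (Euclidean_space m) (\<phi> ` (D \<inter> (c \<circ> ?G \<circ> inv c) -` E))"
      have eqs: "m = n" "D = ?B" "\<phi> = inv c" "m' = n" "\<psi> = inv c"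
        using a bR by (auto simp: in_atlas_open_submfd atlas_Rn_smooth)
      have "inv c ` ?B = cuboid n A" using c by (simp add: image_inv_f_f)
      moreover have "smooth_between n n (cuboid n A) ?G"
        using line \<sigma> by (intro smooth_between_coordinate_map[where B = "\<lambda>j. A (\<sigma> j)"])
          (simp_all add: line_diffeo_def cuboid_def)
      ultimately have "smooth_between n n (inv c ` ?B) ?G" by simp
      with inj o show "smooth_between m m' (\<phi> ` (D \<inter> (c \<circ> ?G \<circ> inv c) -` E))
          (\<psi> \<circ> (c \<circ> ?G \<circ> inv c) \<circ> inv_into D \<phi>)"
        unfolding eqs by (rule local_expression)
    qed
  qed
qed

text \<open>
  A chart of the piece is a restricted chart of \<open>X\<close>, and the chart of \<open>R^d\<close> corresponds to the
  chart of the \<open>i\<close>-th summand; so the chart expressions are restrictions of those of \<open>f\<close> and its inverse.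
\<close>
lemma diffeo_pieces_of_disjoint_union:
  fixes X :: "'u mfd"
  assumes c: "inj c" and X: "charted X" and f: "diffeo X (Euclidean_sum d I) f"
  defines "f' \<equiv> inv_into (topspace (mtop X)) f"
  assumes i: "i \<in> I"
  shows "diffeo (Rn_smooth c (d i)) (open_submfd X (summand_piece d f' i)) (\<lambda>u. f' (i, inv c u))"
proof -
  let ?U = "summand_piece d f' i" and ?E = "topspace (Euclidean_space (d i))"
  let ?R = "Rn_smooth c (d i)" and ?S = "Euclidean_sum d I"
  have ff': "homeomorphic_maps (mtop X) (sum_topology (\<lambda>i. Euclidean_space (d i)) I) f f'"
    using diffeo_homeomorphic_maps[OF f] by (simp add: mtop_Euclidean_sum f'_def)
  note pieces = pieces_of_disjoint_union[OF c ff']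
  have U: "openin (mtop X) ?U" using pieces(1) i by (simp add: open_cover_def)
  have R: "charted ?R" by (rule charted_Rn_smooth[OF c])
  have Y: "charted (open_submfd X ?U)" by (rule charted_open_submfd[OF X U])
  have S: "charted ?S" by (rule charted_Euclidean_sum)
  have sm: "smooth_map X ?S f" "smooth_map ?S X f'"
    using f by (simp_all add: diffeo_def f'_def)
  have Si: "(d i, {i} \<times> ?E, snd) \<in> atlas ?S" using i by (simp add: atlas_Euclidean_sum)
  have homeo: "homeomorphic_maps (mtop ?R) (mtop (open_submfd X ?U)) (\<lambda>u. f' (i, inv c u)) (\<lambda>x. c (snd (f x)))"
    unfolding mtop_open_submfd mtop_Rn_smooth by (rule pieces(3)[OF i])
  show ?thesis
  proof (rule diffeoI[OF homeo R Y])
    show "smooth_map ?R (open_submfd X ?U) (\<lambda>u. f' (i, inv c u))"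
    proof (rule smooth_mapI[OF R Y])
      show "continuous_map (mtop ?R) (mtop (open_submfd X ?U)) (\<lambda>u. f' (i, inv c u))"
        using homeo unfolding homeomorphic_maps_def by blast
      fix n D \<phi> m E \<psi>
      assume a: "(n, D, \<phi>) \<in> atlas ?R" "(m, E, \<psi>) \<in> atlas (open_submfd X ?U)" and inj: "inj_on \<phi> D"
        and o: "openin (Euclidean_space n) (\<phi> ` (D \<inter> (\<lambda>u. f' (i, inv c u)) -` E))"
      have eqs: "n = d i" "D = c ` ?E" "\<phi> = inv c" using a(1) by (simp_all add: atlas_Rn_smooth)
      obtain E' where E': "(m, E', \<psi>) \<in> atlas X" "E = E' \<inter> ?U"
        using a(2) by (auto simp: in_atlas_open_submfd)
      show "smooth_between n m (\<phi> ` (D \<inter> (\<lambda>u. f' (i, inv c u)) -` E)) (\<psi> \<circ> (\<lambda>u. f' (i, inv c u)) \<circ> inv_into D \<phi>)"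
      proof (rule smooth_between_transport[where \<tau> = "\<lambda>u. (i, inv c u)", OF _ _ inj o])
        show "smooth_between n m (snd ` (({i} \<times> ?E) \<inter> f' -` E')) (\<psi> \<circ> f' \<circ> inv_into ({i} \<times> ?E) snd)"
          unfolding eqs by (rule smooth_mapD[OF sm(2) Si E'(1)])
        show "inj_on snd ({i} \<times> ?E)" by (rule chart_inj_on[OF chartedD[OF S Si]])
        show "(i, inv c u) \<in> {i} \<times> ?E \<and> f' (i, inv c u) \<in> E' \<and> snd (i, inv c u) = \<phi> u \<and> \<psi> (f' (i, inv c u)) = \<psi> (f' (i, inv c u))"
          if "u \<in> D" "f' (i, inv c u) \<in> E" for u
          using that c by (auto simp: eqs E'(2))
      qed
    qed
    show "smooth_map (open_submfd X ?U) ?R (\<lambda>x. c (snd (f x)))"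
    proof (rule smooth_mapI[OF Y R])
      show "continuous_map (mtop (open_submfd X ?U)) (mtop ?R) (\<lambda>x. c (snd (f x)))"
        using homeo unfolding homeomorphic_maps_def by blast
      fix n D \<phi> m E \<psi>
      assume a: "(n, D, \<phi>) \<in> atlas (open_submfd X ?U)" "(m, E, \<psi>) \<in> atlas ?R" and inj: "inj_on \<phi> D"
        and o: "openin (Euclidean_space n) (\<phi> ` (D \<inter> (\<lambda>x. c (snd (f x))) -` E))"
      have eqs: "m = d i" "E = c ` ?E" "\<psi> = inv c" using a(2) by (simp_all add: atlas_Rn_smooth)
      obtain D' where D': "(n, D', \<phi>) \<in> atlas X" "D = D' \<inter> ?U"
        using a(1) by (auto simp: in_atlas_open_submfd)
      show "smooth_between n m (\<phi> ` (D \<inter> (\<lambda>x. c (snd (f x))) -` E)) (\<psi> \<circ> (\<lambda>x. c (snd (f x))) \<circ> inv_into D \<phi>)"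
      proof (rule smooth_between_transport[where \<tau> = "\<lambda>x. x", OF _ _ inj o])
        show "smooth_between n m (\<phi> ` (D' \<inter> f -` ({i} \<times> ?E))) (snd \<circ> f \<circ> inv_into D' \<phi>)"
          unfolding eqs by (rule smooth_mapD[OF sm(1) D'(1) Si])
        show "inj_on \<phi> D'" by (rule chart_inj_on[OF chartedD[OF X D'(1)]])
        fix x assume x: "x \<in> D" "c (snd (f x)) \<in> E"
        then have "fst (f x) = i \<and> snd (f x) \<in> ?E" using pieces(4)[OF i] D'(2) by blast
        then show "x \<in> D' \<and> f x \<in> {i} \<times> ?E \<and> \<phi> x = \<phi> x \<and> snd (f x) = \<psi> (c (snd (f x)))"
          using x c by (simp add: eqs D'(2) mem_Times_iff)
      qed
    qed
  qed
qed

text \<open>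
  The chart of the \<open>i\<close>-th summand only meets the piece \<open>U i\<close>, where the glued map is given by the inverse
  of \<open>g i\<close>; so its chart expressions are those of \<open>g i\<close> and its inverse.
\<close>
lemma diffeo_disjoint_union_of_pieces:
  fixes X :: "'u mfd"
  assumes c: "inj c" and X: "charted X"
    and U: "open_cover (mtop X) I U" "disjoint_family_on U I"
    and g: "\<And>i. i \<in> I \<Longrightarrow> diffeo (Rn_smooth c (d i)) (open_submfd X (U i)) (g i)"
  shows "\<exists>f. diffeo X (Euclidean_sum d I) f"
proof -
  define g' where "g' i = inv_into (topspace (mtop (Rn_smooth c (d i)))) (g i)" for i
  let ?E = "\<lambda>i. topspace (Euclidean_space (d i))"
  let ?S = "Euclidean_sum d I"
  let ?f = "\<lambda>x. (piece_index I U x, inv c (g' (piece_index I U x) x))" and ?f' = "\<lambda>(i, y). g i (c y)"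
  have gm: "homeomorphic_maps (Rn_top c (d i)) (subtopology (mtop X) (U i)) (g i) (g' i)" if "i \<in> I" for i
    using diffeo_homeomorphic_maps[OF g[OF that]] by (simp add: g'_def mtop_Rn_smooth mtop_open_submfd)
  have homeo: "homeomorphic_maps (mtop X) (mtop ?S) ?f ?f'"
    unfolding mtop_Euclidean_sum by (rule disjoint_union_of_pieces[where g = g and g' = g', OF c U gm])
  have S: "charted ?S" by (rule charted_Euclidean_sum)
  have R: "charted (Rn_smooth c n)" for n by (rule charted_Rn_smooth[OF c])
  have Uop: "openin (mtop X) (U i)" if "i \<in> I" for i using U(1) that by (simp add: open_cover_def)
  have Y: "charted (open_submfd X (U i))" if "i \<in> I" for i
    by (rule charted_open_submfd[OF X Uop[OF that]])
  have sm: "smooth_map (Rn_smooth c (d i)) (open_submfd X (U i)) (g i)"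
    "smooth_map (open_submfd X (U i)) (Rn_smooth c (d i)) (g' i)" if "i \<in> I" for i
    using g[OF that] by (simp_all add: diffeo_def g'_def)
  have Ri: "(n, c ` topspace (Euclidean_space n), inv c) \<in> atlas (Rn_smooth c n)" for n
    by (simp add: atlas_Rn_smooth)
  have restrict: "(n, D \<inter> U i, \<phi>) \<in> atlas (open_submfd X (U i))" if "(n, D, \<phi>) \<in> atlas X" for n D \<phi> i
    using that unfolding in_atlas_open_submfd by blast
  have gU: "g i (c y) \<in> U i" if "i \<in> I" "y \<in> ?E i" for i y
  proof -
    have "continuous_map (Rn_top c (d i)) (subtopology (mtop X) (U i)) (g i)"
      using gm[OF that(1)] unfolding homeomorphic_maps_def by blast
    from continuous_map_image_subset_topspace[OF this] show ?thesis
      using that(2) by (auto simp: topspace_Rn_top[OF c])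
  qed
  have g'R: "g' i x \<in> c ` ?E i" if "i \<in> I" "x \<in> U i" for i x
  proof -
    have "continuous_map (subtopology (mtop X) (U i)) (Rn_top c (d i)) (g' i)"
      using gm[OF that(1)] unfolding homeomorphic_maps_def by blast
    from continuous_map_image_subset_topspace[OF this] show ?thesis
      using that(2) openin_subset[OF Uop[OF that(1)]] by (auto simp: topspace_Rn_top[OF c])
  qed
  have "diffeo X ?S ?f"
  proof (rule diffeoI[OF homeo X S])
    show "smooth_map X ?S ?f"
    proof (rule smooth_mapI[OF X S])
      show "continuous_map (mtop X) (mtop ?S) ?f"
        using homeo unfolding homeomorphic_maps_def by blast
      fix n D \<phi> m E \<psi>
      assume a: "(n, D, \<phi>) \<in> atlas X" "(m, E, \<psi>) \<in> atlas ?S" and inj: "inj_on \<phi> D"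
        and DX: "D \<subseteq> topspace (mtop X)"
        and o: "openin (Euclidean_space n) (\<phi> ` (D \<inter> ?f -` E))"
      obtain i where i: "i \<in> I" and eqs: "m = d i" "E = {i} \<times> ?E i" "\<psi> = snd"
        using a(2) by (auto simp: atlas_Euclidean_sum)
      show "smooth_between n m (\<phi> ` (D \<inter> ?f -` E)) (\<psi> \<circ> ?f \<circ> inv_into D \<phi>)"
      proof (rule smooth_between_transport[where \<tau> = "\<lambda>x. x", OF _ _ inj o])
        show "smooth_between n m (\<phi> ` (D \<inter> U i \<inter> g' i -` (c ` ?E i))) (inv c \<circ> g' i \<circ> inv_into (D \<inter> U i) \<phi>)"
          unfolding eqs by (rule smooth_mapD[OF sm(2)[OF i] restrict[OF a(1)] Ri])
        show "inj_on \<phi> (D \<inter> U i)" by (rule inj_on_subset[OF inj]) simp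
        fix x assume x: "x \<in> D" "?f x \<in> E"
        have "x \<in> (\<Union>j\<in>I. U j)" using x(1) DX U(1) unfolding open_cover_def by blast
        then obtain j where j: "j \<in> I" "x \<in> U j" by (rule UN_E)
        have "piece_index I U x = j" by (rule piece_index_eq[OF U(2) j])
        moreover have "piece_index I U x = i" using x(2) by (simp add: eqs)
        ultimately have pi: "piece_index I U x = i" "x \<in> U i" using j by simp_all
        then show "x \<in> D \<inter> U i \<and> g' i x \<in> c ` ?E i \<and> \<phi> x = \<phi> x \<and> inv c (g' i x) = \<psi> (?f x)"
          using x(1) g'R[OF i pi(2)] by (simp add: eqs)
      qed
    qed
    show "smooth_map ?S X ?f'"
    proof (rule smooth_mapI[OF S X])
      show "continuous_map (mtop ?S) (mtop X) ?f'"
        using homeo unfolding homeomorphic_maps_def by blast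
      fix n D \<phi> m E \<psi>
      assume a: "(n, D, \<phi>) \<in> atlas ?S" "(m, E, \<psi>) \<in> atlas X" and inj: "inj_on \<phi> D"
        and o: "openin (Euclidean_space n) (\<phi> ` (D \<inter> ?f' -` E))"
      obtain i where i: "i \<in> I" and eqs: "n = d i" "D = {i} \<times> ?E i" "\<phi> = snd"
        using a(1) by (auto simp: atlas_Euclidean_sum)
      show "smooth_between n m (\<phi> ` (D \<inter> ?f' -` E)) (\<psi> \<circ> ?f' \<circ> inv_into D \<phi>)"
      proof (rule smooth_between_transport[where \<tau> = "\<lambda>p. c (snd p)", OF _ _ inj o])
        show "smooth_between n m (inv c ` (c ` ?E i \<inter> g i -` (E \<inter> U i))) (\<psi> \<circ> g i \<circ> inv_into (c ` ?E i) (inv c))"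
          unfolding eqs by (rule smooth_mapD[OF sm(1)[OF i] Ri restrict[OF a(2)]])
        show "inj_on (inv c) (c ` ?E i)" by (rule chart_inj_on[OF chartedD[OF R Ri]])
        fix p assume p: "p \<in> D" "?f' p \<in> E"
        then obtain y where y: "p = (i, y)" "y \<in> ?E i" by (auto simp: eqs)
        then show "c (snd p) \<in> c ` ?E i \<and> g i (c (snd p)) \<in> E \<inter> U i \<and> inv c (c (snd p)) = \<phi> p \<and> \<psi> (g i (c (snd p))) = \<psi> (?f' p)"
          using p gU[OF i y(2)] c by (simp add: eqs)
      qed
    qed
  qed
  then show ?thesis by blast
qed

lemma M_smooth_iff:
  fixes X :: "'u mfd"
  assumes c: "inj c"
  shows "X \<in> M_smooth \<longleftrightarrow> smooth_manifold X \<and>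
     (\<exists>(I :: 'u set) U d g. open_cover (mtop X) I U \<and> disjoint_family_on U I \<and>
        (\<forall>i\<in>I. diffeo (Rn_smooth c (d i)) (open_submfd X (U i)) (g i)))"
proof
  assume "X \<in> M_smooth"
  then obtain I :: "'u set" and d f where X: "smooth_manifold X" and f: "diffeo X (Euclidean_sum d I) f"
    unfolding M_smooth_def by blast
  define f' where "f' = inv_into (topspace (mtop X)) f"
  have ff': "homeomorphic_maps (mtop X) (sum_topology (\<lambda>i. Euclidean_space (d i)) I) f f'"
    using diffeo_homeomorphic_maps[OF f] by (simp add: mtop_Euclidean_sum f'_def)
  have "\<forall>i\<in>I. diffeo (Rn_smooth c (d i)) (open_submfd X (summand_piece d f' i)) (\<lambda>u. f' (i, inv c u))"
    unfolding f'_def by (intro ballI diffeo_pieces_of_disjoint_union[OF c charted_manifold[OF X] f])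
  then show "smooth_manifold X \<and>
     (\<exists>(I :: 'u set) U d g. open_cover (mtop X) I U \<and> disjoint_family_on U I \<and>
        (\<forall>i\<in>I. diffeo (Rn_smooth c (d i)) (open_submfd X (U i)) (g i)))"
    using X pieces_of_disjoint_union(1,2)[OF c ff'] by (intro conjI exI)
next
  assume "smooth_manifold X \<and>
     (\<exists>(I :: 'u set) U d g. open_cover (mtop X) I U \<and> disjoint_family_on U I \<and>
        (\<forall>i\<in>I. diffeo (Rn_smooth c (d i)) (open_submfd X (U i)) (g i)))"
  then obtain I :: "'u set" and U d g where X: "smooth_manifold X"
    and U: "open_cover (mtop X) I U" "disjoint_family_on U I"
    and g: "\<And>i. i \<in> I \<Longrightarrow> diffeo (Rn_smooth c (d i)) (open_submfd X (U i)) (g i)" by blast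
  have "\<exists>f. diffeo X (Euclidean_sum d I) f"
    by (rule diffeo_disjoint_union_of_pieces[OF c charted_manifold[OF X] U g])
  then show "X \<in> M_smooth" unfolding M_smooth_def using X by blast
qed

lemma manifold_class_smooth:
  assumes c: "inj (c :: (nat \<Rightarrow> real) \<Rightarrow> 'u)"
  shows "manifold_class mtop open_submfd diffeo (Rn_smooth c) c (M_smooth :: 'u mfd set) smooth_manifold"
proof
  show "inj c" by (rule c)
  show "homeomorphic_map (mtop X) (mtop Y) f" if "diffeo X Y f" for X Y :: "'u mfd" and f
    using diffeo_homeomorphic_maps[OF that] homeomorphic_maps_map by blast
  show "open_submfd X (topspace (mtop X)) = X" if "smooth_manifold X" for X :: "'u mfd"
    by (rule open_submfd_topspace[OF charted_manifold[OF that]])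
qed (fact mtop_Rn_smooth mtop_open_submfd open_submfd_open_submfd smooth_manifold_Rn_smooth[OF c]
      smooth_manifold_open_submfd diffeo_cuboid[OF c] M_smooth_iff[OF c])+

theorem theorem1p3:
  fixes c :: "(nat \<Rightarrow> real) \<Rightarrow> 'u"
  assumes "inj c"
  shows "is_smallest
           (admissible (\<lambda>X. X) subtopology homeomorphic_map (Rn_top c) c (M_top :: 'u topology set))
           (all_covers (\<lambda>X. X) (M_top :: 'u topology set)) \<and>
         is_smallest
           (admissible mtop open_submfd diffeo (Rn_smooth c) c (M_smooth :: 'u mfd set))
           (all_covers mtop (M_smooth :: 'u mfd set))"
proof
  show "is_smallest
           (admissible (\<lambda>X. X) subtopology homeomorphic_map (Rn_top c) c (M_top :: 'u topology set))
           (all_covers (\<lambda>X. X) (M_top :: 'u topology set))"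
    by (rule manifold_class.all_covers_is_smallest[OF manifold_class_top[OF assms]])
  show "is_smallest
           (admissible mtop open_submfd diffeo (Rn_smooth c) c (M_smooth :: 'u mfd set))
           (all_covers mtop (M_smooth :: 'u mfd set))"
    by (rule manifold_class.all_covers_is_smallest[OF manifold_class_smooth[OF assms]])
qed

end
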